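(* Let $d\geq 2$, $N\geq 1$, let $A,B\in\mathbb{C}^{N,N}$ be simultaneously diagonalizable (over $\mathbb{C}$) with transformation matrix $Y\in\mathbb{C}^{N,N}$, let every eigenvalue of $A$ have positive real part, and let $S\in\mathbb{R}^{d,d}$ be skew-symmetric. Let $\omega_{\mathrm b}=-b_0$ and $M_{\mathrm b}=\kappa a_1^{d/2}$ (constants as in the context), and let $\lambda\in\mathbb{C}$ with $\mathrm{Re}\,\lambda>\omega_{\mathrm b}$. Let $(A_{\mathrm b},\mathcal{D}(A_{\mathrm b}))$ be the infinitesimal generator of the $C_0$-semigroup $(T(t))_{t\geq0}$ on $C_{\mathrm{rub}}(\mathbb{R}^d,\mathbb{C}^N)$ defined in the context. Then for every $g\in C_{\mathrm{rub}}(\mathbb{R}^d,\mathbb{C}^N)$ the resolvent equation $$(\lambda I-A_{\mathrm b})v=g$$ admits a unique solution $v_\star\in\mathcal{D}(A_{\mathrm b})$, which is given by $$v_\star=(\lambda I-A_{\mathrm b})^{-1}g=\int_0^\infty e^{-\lambda t}T(t)g\,dt=\int_0^\infty e^{-\lambda t}\int_{\mathbb{R}^d}H(\cdot,\xi,t)g(\xi)\,d\xi\,dt.$$ Moreover, $$\|v_\star\|_{C_{\mathrm b}(\mathbb{R}^d,\mathbb{C}^N)}\leq\frac{M_{\mathrm b}}{\mathrm{Re}\,\lambda-\omega_{\mathrm b}}\|g\|_{C_{\mathrm b}(\mathbb{R}^d,\mathbb{C}^N)}.$$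
   Context: $C_{\mathrm b}(\mathbb{R}^d,\mathbb{C}^N)$ is the space of bounded continuous functions with the sup-norm; $C_{\mathrm{ub}}(\mathbb{R}^d,\mathbb{C}^N)$ is its subspace of uniformly continuous functions; $C_{\mathrm{rub}}(\mathbb{R}^d,\mathbb{C}^N)=\{v\in C_{\mathrm{ub}}(\mathbb{R}^d,\mathbb{C}^N):\lim_{t\to0}\sup_{x\in\mathbb{R}^d}|v(e^{-tS}x)-v(x)|=0\}$, with the sup-norm. Semigroup: $T(0)=I$ and $[T(t)v](x)=\int_{\mathbb{R}^d}H(x,\xi,t)v(\xi)\,d\xi$ for $t>0$, where $H(x,\xi,t)=(4\pi tA)^{-d/2}\exp(-Bt-(4tA)^{-1}|e^{tS}x-\xi|^2)$. Matrix powers: if $A=Y\,\mathrm{diag}(\lambda_k)\,Y^{-1}$ then $(4\pi tA)^{-d/2}=Y\,\mathrm{diag}((4\pi t\lambda_k)^{-d/2})\,Y^{-1}$, with $z^{-d/2}=\exp(-\frac d2\mathrm{Log}\,z)$, $\mathrm{Log}$ the principal logarithm. This is a $C_0$-semigroup on $C_{\mathrm{rub}}(\mathbb{R}^d,\mathbb{C}^N)$; its generator is $A_{\mathrm b}v=\lim_{t\downarrow0}\frac{T(t)v-v}{t}$ on the domain $\mathcal{D}(A_{\mathrm b})$ of all $v\in C_{\mathrm{rub}}$ for which the limit exists in $C_{\mathrm{rub}}$. Constants: $a_{\min}=\min_{\lambda\in\sigma(A)}|\lambda|$, $a_{\max}=\max_{\lambda\in\sigma(A)}|\lambda|$, $a_0=\min_{\lambda\in\sigma(A)}\mathrm{Re}\,\lambda$,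 $b_0=\min_{\mu\in\sigma(B)}\mathrm{Re}\,\mu$, $a_1=\frac{a_{\max}^2}{a_{\min}a_0}$, $\kappa=|Y||Y^{-1}|$ (spectral norm), where $Y^{-1}AY$ and $Y^{-1}BY$ are diagonal. *)

theory Defs
  imports "HOL-Analysis.Analysis"
begin

section \<open>Matrix functions\<close>

definition spectrum :: "complex^'n^'n \<Rightarrow> complex set" where
  "spectrum M = {\<mu>. \<exists>v. v \<noteq> 0 \<and> M *v v = \<mu> *s v}"

definition diag_mat :: "('n \<Rightarrow> complex) \<Rightarrow> complex^'n^'n" where
  "diag_mat l = (\<chi> i j. if i = j then l i else 0)"

definition diagonalizes :: "complex^'n^'n \<Rightarrow> complex^'n^'n \<Rightarrow> bool" where
  "diagonalizes Y M \<longleftrightarrow> invertible Y \<and> (\<exists>l. matrix_inv Y ** M ** Y = diag_mat l)"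

primrec mat_pow :: "'a::semiring_1^'n^'n \<Rightarrow> nat \<Rightarrow> 'a^'n^'n" where
  "mat_pow M 0 = mat 1"
| "mat_pow M (Suc k) = M ** mat_pow M k"

text \<open>The overloaded \<^const>\<open>exp\<close> is not available here: the library's multiplication on vectors of
  vectors is componentwise, not the matrix product.\<close>

definition mat_exp :: "'a::real_normed_field^'n^'n \<Rightarrow> 'a^'n^'n" where
  "mat_exp M = (\<Sum>k. mat_pow M k /\<^sub>R fact k)"

text \<open>The complex power \<open>M\<^sup>s\<close> of a diagonalizable matrix (with nonzero eigenvalues), taken with the
  principal logarithm; the lemma \<open>mat_powr_eq\<close> below shows that it does not depend on the
  diagonalization chosen.\<close>

definition mat_powr :: "complex^'n^'n \<Rightarrow> complex \<Rightarrow> complex^'n^'n" where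
  "mat_powr M s = (THE P. \<exists>(Y :: complex^'n^'n) l. invertible Y \<and> M = Y ** diag_mat l ** matrix_inv Y \<and>
     P = Y ** diag_mat (\<lambda>k. exp (s * Ln (l k))) ** matrix_inv Y)"

lemma matrix_inv_both:
  assumes "invertible (Y :: complex^'n^'n)"
  shows "Y ** matrix_inv Y = mat 1" "matrix_inv Y ** Y = mat 1"
  using someI_ex[of "\<lambda>Z. Y ** Z = mat 1 \<and> Z ** Y = mat 1"] assms
  unfolding invertible_def matrix_inv_def by blast+

lemma diag_mat_mult_left: "(diag_mat l ** P) $ i $ j = l i * P $ i $ j"
  by (simp add: diag_mat_def matrix_matrix_mult_def if_distrib if_distribR sum.delta cong: if_cong)

lemma diag_mat_mult_right: "(P ** diag_mat l) $ i $ j = P $ i $ j * l j"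
  by (simp add: diag_mat_def matrix_matrix_mult_def if_distrib if_distribR sum.delta cong: if_cong)

lemma diag_fun_unique:
  assumes Y: "invertible (Y :: complex^'n^'n)" and Z: "invertible (Z :: complex^'n^'n)"
    and eq: "Y ** diag_mat l ** matrix_inv Y = Z ** diag_mat m ** matrix_inv Z"
  shows "Y ** diag_mat (\<lambda>k. f (l k)) ** matrix_inv Y = Z ** diag_mat (\<lambda>k. f (m k)) ** matrix_inv Z"
proof -
  define P where "P = matrix_inv Y ** Z"
  have YP: "Y ** P = Z"
    by (simp add: P_def matrix_mul_assoc matrix_inv_both[OF Y])
  have PZ: "P ** matrix_inv Z = matrix_inv Y"
    by (simp add: P_def matrix_mul_assoc[symmetric] matrix_inv_both[OF Z])
  have "diag_mat l ** P = matrix_inv Y ** (Y ** diag_mat l ** matrix_inv Y) ** Z"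
    by (simp add: P_def matrix_mul_assoc matrix_inv_both[OF Y])
  also have "\<dots> = P ** diag_mat m ** (matrix_inv Z ** Z)"
    by (simp add: eq P_def matrix_mul_assoc)
  finally have com: "diag_mat l ** P = P ** diag_mat m"
    by (simp add: matrix_inv_both[OF Z])
  have ent: "l i * P $ i $ j = P $ i $ j * m j" for i j
    using arg_cong[OF com, of "\<lambda>X. X $ i $ j"] by (simp only: diag_mat_mult_left diag_mat_mult_right)
  have "f (l i) * P $ i $ j = P $ i $ j * f (m j)" for i j
    using ent[of i j] by (cases "P $ i $ j = 0") auto
  then have com': "diag_mat (\<lambda>k. f (l k)) ** P = P ** diag_mat (\<lambda>k. f (m k))"
    by (simp add: vec_eq_iff diag_mat_mult_left diag_mat_mult_right)
  have "Y ** diag_mat (\<lambda>k. f (l k)) ** matrix_inv Y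
      = Y ** (diag_mat (\<lambda>k. f (l k)) ** P) ** matrix_inv Z"
    by (simp add: PZ[symmetric] matrix_mul_assoc)
  also have "\<dots> = Z ** diag_mat (\<lambda>k. f (m k)) ** matrix_inv Z"
    by (simp add: com' matrix_mul_assoc YP)
  finally show ?thesis .
qed

lemma mat_powr_eq:
  assumes "invertible (Y :: complex^'n^'n)" "M = Y ** diag_mat l ** matrix_inv Y"
  shows "mat_powr M s = Y ** diag_mat (\<lambda>k. exp (s * Ln (l k))) ** matrix_inv Y"
  unfolding mat_powr_def
proof (rule the_equality)
  show "\<exists>(Y' :: complex^'n^'n) l'. invertible Y' \<and> M = Y' ** diag_mat l' ** matrix_inv Y' \<and>
     Y ** diag_mat (\<lambda>k. exp (s * Ln (l k))) ** matrix_inv Y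
     = Y' ** diag_mat (\<lambda>k. exp (s * Ln (l' k))) ** matrix_inv Y'"
    using assms by blast
next
  fix P
  assume "\<exists>(Y' :: complex^'n^'n) l'. invertible Y' \<and> M = Y' ** diag_mat l' ** matrix_inv Y' \<and>
     P = Y' ** diag_mat (\<lambda>k. exp (s * Ln (l' k))) ** matrix_inv Y'"
  then show "P = Y ** diag_mat (\<lambda>k. exp (s * Ln (l k))) ** matrix_inv Y"
    using diag_fun_unique[of _ Y _ l "\<lambda>z. exp (s * Ln z)"] assms by metis
qed


section \<open>The constants\<close>

definition a_min :: "complex^'n^'n \<Rightarrow> real" where
  "a_min A = Min (norm ` spectrum A)"

definition a_max :: "complex^'n^'n \<Rightarrow> real" where
  "a_max A = Max (norm ` spectrum A)"

text \<open>This is \<open>a\<^sub>0\<close> for the matrix \<open>A\<close> and \<open>b\<^sub>0\<close> for the matrix \<open>B\<close>.\<close>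

definition min_Re_spec :: "complex^'n^'n \<Rightarrow> real" where
  "min_Re_spec M = Min (Re ` spectrum M)"

definition a_one :: "complex^'n^'n \<Rightarrow> real" where
  "a_one A = (a_max A)\<^sup>2 / (a_min A * min_Re_spec A)"

definition spectral_norm :: "complex^'n^'n \<Rightarrow> real" where
  "spectral_norm M = onorm (\<lambda>v. M *v v)"

definition cond_number :: "complex^'n^'n \<Rightarrow> real" where
  "cond_number Y = spectral_norm Y * spectral_norm (matrix_inv Y)"


section \<open>The function space and the semigroup\<close>

text \<open>Bounded continuous functions are elements of the library type \<^typ>\<open>(real^'d) \<Rightarrow>\<^sub>C (complex^'n)\<close>,
  whose norm is the sup-norm. The library provides only its real vector space structure.\<close>

definition cscale :: "complex \<Rightarrow> ('a::topological_space \<Rightarrow>\<^sub>C (complex^'n)) \<Rightarrow> ('a \<Rightarrow>\<^sub>C (complex^'n))" where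
  "cscale c v = Bcontfun (\<lambda>x. c *s v x)"

lemma apply_cscale [simp]:
  fixes v :: "'a::topological_space \<Rightarrow>\<^sub>C (complex^'n)"
  shows "apply_bcontfun (cscale c v) x = c *s v x"
proof -
  have lin: "bounded_linear (\<lambda>u :: complex^'n. c *s u)"
    by (intro linear_conv_bounded_linear[THEN iffD1] linearI)
       (simp_all add: vec_eq_iff algebra_simps)
  have "continuous_on UNIV (\<lambda>x. c *s v x)"
    by (intro bounded_linear.continuous_on[OF lin]) simp
  moreover have "bounded (range (\<lambda>x. c *s v x))"
    using bounded_linear_image[OF _ lin, of "range v"] by (simp add: image_image)
  ultimately have "(\<lambda>x. c *s v x) \<in> bcontfun" by (simp add: bcontfun_def)
  then show ?thesis by (simp add: cscale_def Bcontfun_inverse)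
qed

definition C_rub :: "real^'d^'d \<Rightarrow> ((real^'d) \<Rightarrow>\<^sub>C (complex^'n)) set" where
  "C_rub S = {v. uniformly_continuous_on UNIV (apply_bcontfun v) \<and>
     ((\<lambda>t. SUP x. norm (v (mat_exp (- t *\<^sub>R S) *v x) - v x)) \<longlongrightarrow> 0) (at 0)}"

definition heat_kernel ::
  "complex^'n^'n \<Rightarrow> complex^'n^'n \<Rightarrow> real^'d^'d \<Rightarrow> real^'d \<Rightarrow> real^'d \<Rightarrow> real \<Rightarrow> complex^'n^'n" where
  "heat_kernel A B S x \<xi> t =
     mat_powr ((4 * pi * t) *\<^sub>R A) (- of_nat CARD('d) / 2) **
     mat_exp (- (t *\<^sub>R B) -
       (norm (mat_exp (t *\<^sub>R S) *v x - \<xi>))\<^sup>2 *\<^sub>R matrix_inv ((4 * t) *\<^sub>R A))"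

text \<open>Only \<open>t \<ge> 0\<close> is meaningful. For \<open>t > 0\<close>, if \<open>A\<close> is diagonalizable with eigenvalues of positive
  real part, the integral below exists for every bounded continuous \<open>v\<close> and defines a bounded
  continuous function of \<open>x\<close>, so that \<^const>\<open>Bcontfun\<close> is applied within its range of definition.\<close>

definition OU_semigroup ::
  "complex^'n^'n \<Rightarrow> complex^'n^'n \<Rightarrow> real^'d^'d \<Rightarrow> real \<Rightarrow>
   ((real^'d) \<Rightarrow>\<^sub>C (complex^'n)) \<Rightarrow> ((real^'d) \<Rightarrow>\<^sub>C (complex^'n))" where
  "OU_semigroup A B S t v =
     (if t = 0 then v
      else Bcontfun (\<lambda>x. \<integral>\<xi>. heat_kernel A B S x \<xi> t *v v \<xi> \<partial>lborel))"

text \<open>Infinitesimal generator of a family of maps \<open>T\<close> on a subspace \<open>X\<close> of a normed space.\<close>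

definition generator_dom ::
  "'v::real_normed_vector set \<Rightarrow> (real \<Rightarrow> 'v \<Rightarrow> 'v) \<Rightarrow> 'v set" where
  "generator_dom X T = {v \<in> X. \<exists>w\<in>X. ((\<lambda>t. (T t v - v) /\<^sub>R t) \<longlongrightarrow> w) (at_right 0)}"

definition generator :: "(real \<Rightarrow> 'v \<Rightarrow> 'v) \<Rightarrow> 'v::real_normed_vector \<Rightarrow> 'v" where
  "generator T v = Lim (at_right 0) (\<lambda>t. (T t v - v) /\<^sub>R t)"

definition D_b ::
  "complex^'n^'n \<Rightarrow> complex^'n^'n \<Rightarrow> real^'d^'d \<Rightarrow> ((real^'d) \<Rightarrow>\<^sub>C (complex^'n)) set" where
  "D_b A B S = generator_dom (C_rub S) (OU_semigroup A B S)"

definition A_b ::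
  "complex^'n^'n \<Rightarrow> complex^'n^'n \<Rightarrow> real^'d^'d \<Rightarrow>
   ((real^'d) \<Rightarrow>\<^sub>C (complex^'n)) \<Rightarrow> ((real^'d) \<Rightarrow>\<^sub>C (complex^'n))" where
  "A_b A B S = generator (OU_semigroup A B S)"

end

theory Submission
  imports Defs "HOL-Probability.Distributions" "HOL-Complex_Analysis.Conformal_Mappings"
begin

text \<open>
  The substitution \<open>\<xi> = e\<^sup>t\<^sup>S x - \<surd>t z\<close> turns the semigroup into
  \<open>[T(t)v](x) = \<integral> e\<^sup>-\<^sup>t\<^sup>B G(z) v(e\<^sup>t\<^sup>S x - \<surd>t z) dz\<close> with a fixed matrix Gaussian \<open>G\<close>. In the
  diagonalizing basis \<open>G\<close> consists of scalar Gaussians with complex variance, which have integral 1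
  by analytic continuation from real variances; the semigroup law is then a completion of the square
  in which only real shifts occur, because the times are real. All entries of \<open>G\<close> are dominated by
  one real Gaussian with integral \<open>a\<^sub>1\<^sup>d\<^sup>/\<^sup>2\<close>, whence \<open>\<parallel>T(t)\<parallel> \<le> M\<^sub>b e\<^sup>-\<^sup>b\<^sup>0\<^sup>t\<close>; its second moment gives strong
  continuity on the rotationally uniformly continuous functions. So \<open>U(t) = e\<^sup>-\<^sup>\<lambda>\<^sup>t T(t)\<close> is an
  exponentially stable semigroup with generator \<open>A\<^sub>b - \<lambda>\<close>, and \<open>R = \<integral>\<^sub>0\<^sup>\<infinity> U(t) dt\<close> inverts \<open>\<lambda> - A\<^sub>b\<close>:
  \<open>U(h) R g - R g = - \<integral>\<^sub>0\<^sup>h U(t) g dt\<close> gives a solution, and since \<open>R\<close> is bounded and commutes with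
  \<open>U(h)\<close>, also \<open>R (\<lambda> - A\<^sub>b) w = w\<close>.
\<close>

section \<open>Exponentially stable semigroups\<close>

instance bcontfun :: (metric_space, banach) banach ..


lemma has_integral_closed_subspace:
  fixes f :: "real \<Rightarrow> 'a::real_normed_vector"
  assumes f: "(f has_integral y) {a..b}" and X: "subspace X" "closed X"
    and fX: "\<And>t. t \<in> {a..b} \<Longrightarrow> f t \<in> X"
  shows "y \<in> X"
proof -
  have "\<exists>z\<in>X. dist z y < e" if "e > 0" for e
  proof -
    from f[unfolded cbox_interval[symmetric] has_integral, rule_format, OF that] obtain \<gamma>
      where \<gamma>: "gauge \<gamma>"
        and *: "\<And>\<D>. \<D> tagged_division_of cbox a b \<and> \<gamma> fine \<D> \<Longrightarrow>
          norm ((\<Sum>(x,k)\<in>\<D>. measure lborel k *\<^sub>R f x) - y) < e"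
      by blast
    obtain p where p: "p tagged_division_of cbox a b" "\<gamma> fine p"
      using fine_division_exists[OF \<gamma>] by blast
    have "(\<Sum>(x,k)\<in>p. measure lborel k *\<^sub>R f x) \<in> X"
      using tag_in_interval[OF p(1)] fX
      by (intro subspace_sum[OF X(1)]) (auto intro!: subspace_scale[OF X(1)])
    with *[of p] p show ?thesis by (auto simp: dist_norm)
  qed
  then have "y \<in> closure X" by (simp add: closure_approachable)
  with X(2) show ?thesis by simp
qed

lemma has_integral_atLeast_limit:
  fixes f :: "real \<Rightarrow> 'a::banach"
  assumes cont: "continuous_on {0..} f" and lim: "((\<lambda>b. integral {0..b} f) \<longlongrightarrow> I) at_top"
  shows "(f has_integral I) {0..}"
proof -
  have int: "f integrable_on {0..b}" for b
    by (intro integrable_continuous_real continuous_on_subset[OF cont]) auto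
  have eq: "((\<lambda>x. if x \<in> {0..} then f x else 0) has_integral (integral {0..b} f)) {a..b}" if "a \<le> 0" for a b
  proof -
    have "(f has_integral integral {0..b} f) {0..b}" using int by blast
    then have "((\<lambda>x. if x \<in> {0..b} then f x else 0) has_integral (integral {0..b} f)) {a..b}"
      using that by (subst has_integral_restrict) auto
    then show ?thesis
      by (rule has_integral_eq[rotated]) auto
  qed
  show ?thesis
  proof (rule has_integral'[THEN iffD2], intro allI impI)
    fix e :: real assume "e > 0"
    from tendstoD[OF lim this] obtain N where N: "\<And>b. b \<ge> N \<Longrightarrow> dist (integral {0..b} f) I < e"
      unfolding eventually_at_top_linorder by blast
    show "\<exists>B>0. \<forall>a b. ball 0 B \<subseteq> cbox a b \<longrightarrow>
        (\<exists>z. ((\<lambda>x. if x \<in> {0..} then f x else 0) has_integral z) (cbox a b) \<and> norm (z - I) < e)"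
    proof (intro exI[of _ "max N 0 + 1"] conjI allI impI)
      fix a b :: real assume sub: "ball 0 (max N 0 + 1) \<subseteq> cbox a b"
      have "max N 0 \<in> ball 0 (max N 0 + 1)" "0 \<in> ball 0 (max N 0 + 1)"
        by (simp_all add: dist_norm)
      with sub have "max N 0 \<in> cbox a b" "0 \<in> cbox a b" by blast+
      then have ab: "a \<le> 0" "N \<le> b" by auto
      show "\<exists>z. ((\<lambda>x. if x \<in> {0..} then f x else 0) has_integral z) (cbox a b) \<and> norm (z - I) < e"
        using eq[OF ab(1), of b] N[OF ab(2)]
        by (intro exI[of _ "integral {0..b} f"]) (simp add: dist_norm cbox_interval)
    qed simp
  qed
qed

lemma exp_decay_has_integral:
  fixes f :: "real \<Rightarrow> 'a::banach"
  assumes cont: "continuous_on {0..} f" and \<delta>: "\<delta> > 0"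
    and bound: "\<And>t. t \<ge> 0 \<Longrightarrow> norm (f t) \<le> C * exp (- \<delta> * t)"
  obtains I where "(f has_integral I) {0..}" "((\<lambda>b. integral {0..b} f) \<longlongrightarrow> I) at_top" "norm I \<le> C / \<delta>"
proof -
  have int: "f integrable_on {a..b}" if "a \<ge> 0" for a b
    using that by (intro integrable_continuous_real continuous_on_subset[OF cont]) auto
  have C: "C \<ge> 0" using bound[of 0] norm_ge_zero[of "f 0"] by (simp del: norm_ge_zero)
  have exp_int: "((\<lambda>t. C * exp (- \<delta> * t)) has_integral (C / \<delta> * (exp (- \<delta> * a) - exp (- \<delta> * b)))) {a..b}"
    if "a \<le> b" for a b
  proof -
    have "((\<lambda>t. C * exp (- \<delta> * t)) has_integral (- (C / \<delta>) * exp (- \<delta> * b) - - (C / \<delta>) * exp (- \<delta> * a))) {a..b}"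
      using \<delta> by (intro fundamental_theorem_of_calculus that)
        (auto intro!: derivative_eq_intros simp: has_real_derivative_iff_has_vector_derivative[symmetric])
    then show ?thesis by (simp add: algebra_simps)
  qed
  have tail: "norm (integral {a..b} f) \<le> C / \<delta> * (exp (- \<delta> * a) - exp (- \<delta> * b))"
    if "0 \<le> a" "a \<le> b" for a b
  proof -
    have "norm (integral {a..b} f) \<le> integral {a..b} (\<lambda>t. C * exp (- \<delta> * t))"
      using that bound has_integral_integrable[OF exp_int[OF that(2)]]
      by (intro integral_norm_bound_integral int) auto
    then show ?thesis using integral_unique[OF exp_int[OF that(2)]] by simp
  qed
  have lim0: "((\<lambda>b. C / \<delta> * exp (- \<delta> * b)) \<longlongrightarrow> 0) at_top"
  proof -
    have "((\<lambda>b. exp (- \<delta> * b)) \<longlongrightarrow> 0) at_top"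
      using \<delta> by (intro filterlim_compose[OF exp_at_bot] filterlim_tendsto_neg_mult_at_bot[OF tendsto_const] filterlim_ident) auto
    from tendsto_mult_left[OF this, of "C / \<delta>"] show ?thesis by simp
  qed
  have "\<exists>I. ((\<lambda>b. integral {0..b} f) \<longlongrightarrow> I) at_top"
  proof -
    have "cauchy_filter (filtermap (\<lambda>b. integral {0..b} f) at_top)"
      unfolding cauchy_filter_metric_filtermap
    proof (intro allI impI)
      fix e :: real assume "e > 0"
      from tendstoD[OF lim0 this] obtain N where N: "\<And>b. b \<ge> N \<Longrightarrow> C / \<delta> * exp (- \<delta> * b) < e"
        using C \<delta> by (auto simp: eventually_at_top_linorder)
      have *: "dist (integral {0..x} f) (integral {0..y} f) < e" if "max N 0 \<le> x" "x \<le> y" for x y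
      proof -
        have "integral {0..x} f + integral {x..y} f = integral {0..y} f"
          using that by (intro Henstock_Kurzweil_Integration.integral_combine int) auto
        then have "dist (integral {0..x} f) (integral {0..y} f) = norm (integral {x..y} f)"
          by (metis add_diff_cancel_left' dist_commute dist_norm)
        also have "\<dots> \<le> C / \<delta> * exp (- \<delta> * x)"
        proof -
          have "C / \<delta> * exp (- \<delta> * y) \<ge> 0" using C \<delta> by simp
          then show ?thesis using tail[of x y] that by (simp add: right_diff_distrib)
        qed
        also have "\<dots> < e" using N that by simp
        finally show ?thesis .
      qed
      show "\<exists>P. eventually P at_top \<and> (\<forall>x y. P x \<and> P y \<longrightarrow> dist (integral {0..x} f) (integral {0..y} f) < e)"
        by (intro exI[of _ "\<lambda>x. x \<ge> max N 0"] conjI eventually_ge_at_top)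
         (use * dist_commute in \<open>metis nle_le\<close>)
    qed
    then show ?thesis
      using cauchy_filter_complete_converges[of "filtermap (\<lambda>b. integral {0..b} f) at_top" UNIV]
      by (auto simp: filterlim_def complete_UNIV filtermap_bot_iff)
  qed
  then obtain I where I: "((\<lambda>b. integral {0..b} f) \<longlongrightarrow> I) at_top" by blast
  have "norm I \<le> C / \<delta>"
  proof (rule tendsto_upperbound[OF tendsto_norm[OF I]])
    show "\<forall>\<^sub>F b in at_top. norm (integral {0..b} f) \<le> C / \<delta>"
      using eventually_ge_at_top[of 0]
    proof eventually_elim
      case (elim b)
      have "C / \<delta> * exp (- \<delta> * b) \<ge> 0" using C \<delta> by simp
      then show ?case using tail[of 0 b] elim by (simp add: right_diff_distrib)
    qed
  qed simp
  show thesis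
    by (rule that[OF has_integral_atLeast_limit[OF cont I] I \<open>norm I \<le> C / \<delta>\<close>])
qed

locale stable_semigroup =
  fixes X :: "'v::banach set" and U :: "real \<Rightarrow> 'v \<Rightarrow> 'v" and M \<delta> :: real
  assumes X: "subspace X" "closed X"
    and lin: "\<And>t. t \<ge> 0 \<Longrightarrow> bounded_linear (U t)"
    and inv: "\<And>t v. t \<ge> 0 \<Longrightarrow> v \<in> X \<Longrightarrow> U t v \<in> X"
    and U_zero: "\<And>v. U 0 v = v"
    and U_add: "\<And>s t v. s \<ge> 0 \<Longrightarrow> t \<ge> 0 \<Longrightarrow> U (s + t) v = U s (U t v)"
    and bound: "\<And>t v. t \<ge> 0 \<Longrightarrow> norm (U t v) \<le> M * exp (- \<delta> * t) * norm v"
    and \<delta>: "\<delta> > 0"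
    and cont0: "\<And>v. v \<in> X \<Longrightarrow> ((\<lambda>t. U t v) \<longlongrightarrow> v) (at_right 0)"
begin

definition R :: "'v \<Rightarrow> 'v" where "R v = integral {0..} (\<lambda>t. U t v)"

lemma bound': "t \<ge> 0 \<Longrightarrow> norm (U t v) \<le> \<bar>M\<bar> * norm v"
proof -
  assume t: "t \<ge> 0"
  have "M * exp (- \<delta> * t) * norm v \<le> \<bar>M\<bar> * 1 * norm v"
    using t \<delta> by (intro mult_mono) auto
  with bound[OF t, of v] show ?thesis by simp
qed

lemma continuous_orbit:
  assumes v: "v \<in> X" shows "continuous_on {0..} (\<lambda>t. U t v)"
  unfolding continuous_on_iff
proof (intro ballI allI impI)
  fix t e :: real assume t: "t \<in> {0..}" and e: "e > 0"
  have *: "\<bar>M\<bar> + 1 > 0" by simp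
  with e have "e / (\<bar>M\<bar> + 1) > 0" by simp
  from tendstoD[OF cont0[OF v] this] obtain d where d: "d > 0"
    and D: "\<And>h. 0 < h \<Longrightarrow> h < d \<Longrightarrow> dist (U h v) v < e / (\<bar>M\<bar> + 1)"
    unfolding eventually_at_right_field by auto
  have **: "dist (U r v) (U s v) < e" if "0 \<le> r" "r < s" "s < r + d" for r s
  proof -
    have "U s v - U r v = U r (U (s - r) v - v)"
      using U_add[of r "s - r" v] that by (simp add: bounded_linear.linear[OF lin] linear_diff)
    then have "dist (U r v) (U s v) = norm (U r (U (s - r) v - v))"
      by (metis dist_commute dist_norm)
    also have "\<dots> \<le> \<bar>M\<bar> * norm (U (s - r) v - v)" using that by (intro bound') auto
    also have "\<dots> \<le> (\<bar>M\<bar> + 1) * norm (U (s - r) v - v)" by (intro mult_right_mono) auto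
    also have "\<dots> < (\<bar>M\<bar> + 1) * (e / (\<bar>M\<bar> + 1))"
      using D[of "s - r"] that * by (intro mult_strict_left_mono) (auto simp: dist_norm)
    also have "\<dots> = e" by simp
    finally show ?thesis .
  qed
  show "\<exists>d>0. \<forall>x'\<in>{0..}. dist x' t < d \<longrightarrow> dist (U x' v) (U t v) < e"
  proof (intro exI[of _ d] conjI ballI impI d)
    fix s assume s: "s \<in> {0..}" "dist s t < d"
    show "dist (U s v) (U t v) < e"
      using **[of s t] **[of t s] s t e
      by (cases s t rule: linorder_cases) (auto simp: dist_real_def dist_commute)
  qed
qed

lemma orbit_integral:
  assumes v: "v \<in> X"
  shows has_integral_R: "((\<lambda>t. U t v) has_integral R v) {0..}"
    and tendsto_R: "((\<lambda>b. integral {0..b} (\<lambda>t. U t v)) \<longlongrightarrow> R v) at_top"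
    and norm_R: "norm (R v) \<le> M / \<delta> * norm v"
proof -
  obtain I where I: "((\<lambda>t. U t v) has_integral I) {0..}"
      "((\<lambda>b. integral {0..b} (\<lambda>t. U t v)) \<longlongrightarrow> I) at_top" "norm I \<le> (M * norm v) / \<delta>"
    by (rule exp_decay_has_integral[OF continuous_orbit[OF v] \<delta>, of "M * norm v"])
      (use bound in \<open>auto simp: mult_ac\<close>)
  have "R v = I" using I(1) by (simp add: R_def integral_unique)
  with I show "((\<lambda>t. U t v) has_integral R v) {0..}"
    "((\<lambda>b. integral {0..b} (\<lambda>t. U t v)) \<longlongrightarrow> R v) at_top" "norm (R v) \<le> M / \<delta> * norm v"
    by auto
qed

lemma orbit_integrable: "v \<in> X \<Longrightarrow> a \<ge> 0 \<Longrightarrow> (\<lambda>t. U t v) integrable_on {a..b}"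
  by (intro integrable_continuous_real continuous_on_subset[OF continuous_orbit]) auto

lemma R_in: assumes v: "v \<in> X" shows "R v \<in> X"
proof (rule Lim_in_closed_set[OF X(2) _ _ tendsto_R[OF v]])
  show "\<forall>\<^sub>F b in at_top. integral {0..b} (\<lambda>t. U t v) \<in> X"
    using orbit_integrable[OF v, of 0]
    by (auto intro!: always_eventually has_integral_closed_subspace[OF integrable_integral X] inv v)
qed simp

lemma R_add: assumes "v \<in> X" "w \<in> X" shows "R (v + w) = R v + R w"
proof -
  have "((\<lambda>t. U t v + U t w) has_integral R v + R w) {0..}"
    by (intro has_integral_add has_integral_R assms)
  then have "((\<lambda>t. U t (v + w)) has_integral R v + R w) {0..}"
    by (rule has_integral_eq[rotated]) (simp add: bounded_linear.linear[OF lin] linear_add)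
  then show ?thesis by (simp add: R_def integral_unique)
qed

lemma R_scale: assumes "v \<in> X" shows "R (c *\<^sub>R v) = c *\<^sub>R R v"
proof -
  have "((\<lambda>t. c *\<^sub>R U t v) has_integral c *\<^sub>R R v) {0..}"
    by (intro has_integral_cmul has_integral_R assms)
  then have "((\<lambda>t. U t (c *\<^sub>R v)) has_integral c *\<^sub>R R v) {0..}"
    by (rule has_integral_eq[rotated]) (simp add: bounded_linear.linear[OF lin] linear_scale)
  then show ?thesis by (simp add: R_def integral_unique)
qed

lemma R_diff: assumes "v \<in> X" "w \<in> X" shows "R (v - w) = R v - R w"
  using R_add[of "v - w" w] assms subspace_diff[OF X(1)] by simp

lemma R_commute: assumes v: "v \<in> X" and h: "h \<ge> 0" shows "R (U h v) = U h (R v)"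
proof -
  have "((\<lambda>t. U h (U t v)) has_integral U h (R v)) {0..}"
    using has_integral_linear[OF has_integral_R[OF v] lin[OF h]] by (simp add: o_def)
  then have "((\<lambda>t. U t (U h v)) has_integral U h (R v)) {0..}"
    by (rule has_integral_eq[rotated]) (simp add: U_add[OF h, symmetric] U_add[OF _ h, symmetric] add.commute)
  then show ?thesis by (simp add: R_def integral_unique)
qed

lemma U_R: assumes v: "v \<in> X" and h: "h \<ge> 0"
  shows "U h (R v) = R v - integral {0..h} (\<lambda>t. U t v)"
proof (rule tendsto_unique)
  interpret bounded_linear "U h" by (rule lin[OF h])
  show "((\<lambda>b. U h (integral {0..b} (\<lambda>t. U t v))) \<longlongrightarrow> U h (R v)) at_top"
    by (intro tendsto tendsto_R v)
  have eq: "U h (integral {0..b} (\<lambda>t. U t v)) =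
      integral {0..b + h} (\<lambda>t. U t v) - integral {0..h} (\<lambda>t. U t v)" if "b \<ge> 0" for b
  proof -
    have "((\<lambda>t. U h (U t v)) has_integral U h (integral {0..b} (\<lambda>t. U t v))) {0..b}"
      using has_integral_linear[OF integrable_integral[OF orbit_integrable[OF v order_refl]] lin[OF h], of b]
      by (simp add: o_def)
    then have "((\<lambda>t. U (h + t) v) has_integral U h (integral {0..b} (\<lambda>t. U t v))) {0..b}"
      by (rule has_integral_eq[rotated]) (use h in \<open>auto simp: U_add\<close>)
    then have "((\<lambda>t. U t v) has_integral U h (integral {0..b} (\<lambda>t. U t v))) {0 + h..b + h}"
      by (subst has_integral_shift_Icc_real[symmetric]) (simp add: o_def)
    then have "integral {h..b + h} (\<lambda>t. U t v) = U h (integral {0..b} (\<lambda>t. U t v))"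
      by (simp add: integral_unique)
    moreover have "integral {0..h} (\<lambda>t. U t v) + integral {h..b + h} (\<lambda>t. U t v)
        = integral {0..b + h} (\<lambda>t. U t v)"
      using h that by (intro Henstock_Kurzweil_Integration.integral_combine orbit_integrable v) auto
    ultimately show ?thesis by (simp add: algebra_simps)
  qed
  have "filterlim (\<lambda>b. b + h) at_top at_top"
    using filterlim_tendsto_add_at_top[OF tendsto_const filterlim_ident, of h]
    by (simp add: add.commute)
  then have "((\<lambda>b. integral {0..b + h} (\<lambda>t. U t v) - integral {0..h} (\<lambda>t. U t v)) \<longlongrightarrow>
      R v - integral {0..h} (\<lambda>t. U t v)) at_top"
    by (intro tendsto_diff tendsto_const filterlim_compose[OF tendsto_R[OF v]])
  then show "((\<lambda>b. U h (integral {0..b} (\<lambda>t. U t v))) \<longlongrightarrow> R v - integral {0..h} (\<lambda>t. U t v)) at_top"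
    by (rule Lim_transform_eventually)
       (use eventually_ge_at_top[of 0] in eventually_elim, simp add: eq)
qed simp

lemma R_generator: assumes v: "v \<in> X"
  shows "((\<lambda>h. (U h (R v) - R v) /\<^sub>R h) \<longlongrightarrow> - v) (at_right 0)"
proof -
  have "((\<lambda>b. integral {0..b} (\<lambda>t. U t v)) has_vector_derivative U 0 v) (at 0 within {0..1})"
    by (rule integral_has_vector_derivative[OF continuous_on_subset[OF continuous_orbit[OF v]]]) auto
  then have "((\<lambda>h. (1 / norm (h - 0)) *\<^sub>R (integral {0..h} (\<lambda>t. U t v) - integral {0..0} (\<lambda>t. U t v) - (h - 0) *\<^sub>R v)) \<longlongrightarrow> 0) (at 0 within {0..1})"
    by (simp add: has_vector_derivative_def has_derivative_within U_zero)
  then have "((\<lambda>h. (1 / norm (h - 0)) *\<^sub>R (integral {0..h} (\<lambda>t. U t v) - (h - 0) *\<^sub>R v)) \<longlongrightarrow> 0) (at_right 0)"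
    by (simp add: at_within_Icc_at_right)
  then have "((\<lambda>h. - (integral {0..h} (\<lambda>t. U t v) /\<^sub>R h - v)) \<longlongrightarrow> - 0) (at_right 0)"
    by (intro tendsto_minus, elim Lim_transform_eventually)
       (auto simp: eventually_at_right_field scaleR_diff_right divide_inverse intro!: exI[of _ 1])
  then have "((\<lambda>h. - v + - (integral {0..h} (\<lambda>t. U t v) /\<^sub>R h - v)) \<longlongrightarrow> - v + - 0) (at_right 0)"
    by (intro tendsto_add tendsto_const)
  then have "((\<lambda>h. - v + - (integral {0..h} (\<lambda>t. U t v) /\<^sub>R h - v)) \<longlongrightarrow> - v) (at_right 0)"
    by simp
  then show ?thesis
    by (rule Lim_transform_eventually)
       (use v in \<open>auto simp: eventually_at_right_field U_R intro!: exI[of _ 1]\<close>)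
qed

lemma generator_R:
  assumes w: "w \<in> X" "y \<in> X" and lim: "((\<lambda>h. (U h w - w) /\<^sub>R h) \<longlongrightarrow> y) (at_right 0)"
  shows "R (- y) = w"
proof -
  have diff: "(U h w - w) /\<^sub>R h \<in> X" if "h > 0" for h
    using that w by (intro subspace_scale[OF X(1)] subspace_diff[OF X(1)] inv) auto
  have "((\<lambda>h. R ((U h w - w) /\<^sub>R h)) \<longlongrightarrow> R y) (at_right 0)"
  proof (rule Lim_null[THEN iffD2], rule Lim_null_comparison)
    show "\<forall>\<^sub>F h in at_right 0. norm (R ((U h w - w) /\<^sub>R h) - R y)
        \<le> M / \<delta> * norm ((U h w - w) /\<^sub>R h - y)"
      unfolding eventually_at_right_field
    proof (intro exI[of _ 1] conjI allI impI)
      fix h :: real assume "0 < h"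
      with diff w have "R ((U h w - w) /\<^sub>R h) - R y = R ((U h w - w) /\<^sub>R h - y)"
        "(U h w - w) /\<^sub>R h - y \<in> X"
        by (simp_all add: R_diff subspace_diff[OF X(1)])
      then show "norm (R ((U h w - w) /\<^sub>R h) - R y) \<le> M / \<delta> * norm ((U h w - w) /\<^sub>R h - y)"
        by (metis norm_R)
    qed simp
    have "((\<lambda>h. norm ((U h w - w) /\<^sub>R h - y)) \<longlongrightarrow> 0) (at_right 0)"
      using lim by (simp add: Lim_null[of _ y] tendsto_norm_zero)
    from tendsto_mult_left[OF this, of "M / \<delta>"]
    show "((\<lambda>h. M / \<delta> * norm ((U h w - w) /\<^sub>R h - y)) \<longlongrightarrow> 0) (at_right 0)" by simp
  qed
  moreover have "((\<lambda>h. R ((U h w - w) /\<^sub>R h)) \<longlongrightarrow> - w) (at_right 0)"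
    using R_generator[OF w(1)]
  proof (rule Lim_transform_eventually)
    show "\<forall>\<^sub>F h in at_right 0. (U h (R w) - R w) /\<^sub>R h = R ((U h w - w) /\<^sub>R h)"
      unfolding eventually_at_right_field
      using w by (intro exI[of _ 1] conjI allI impI)
        (auto simp: R_scale R_diff R_commute inv subspace_diff[OF X(1)])
  qed
  ultimately have "R y = - w" by (rule tendsto_unique[rotated]) simp
  then show ?thesis using R_scale[of y "-1"] w by simp
qed

end

section \<open>Lebesgue measure and Gaussian integrals\<close>

lemma lborel_integral_affine:
  fixes f :: "'a::euclidean_space \<Rightarrow> 'b :: {banach, second_countable_topology}"
  assumes c: "c \<noteq> 0"
  shows "integrable lborel (\<lambda>x. f (t + c *\<^sub>R x)) \<longleftrightarrow> integrable lborel f"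
    and "(\<integral>x. f x \<partial>lborel) = \<bar>c\<bar> ^ DIM('a) *\<^sub>R (\<integral>x. f (t + c *\<^sub>R x) \<partial>lborel)"
proof -
  have imp: "integrable lborel (\<lambda>x. f (t + c *\<^sub>R x))" if f: "integrable lborel f" and c: "c \<noteq> 0"
    for c t and f :: "'a \<Rightarrow> 'b"
  proof -
    have "integrable (density (distr lborel borel (\<lambda>x. t + c *\<^sub>R x)) (\<lambda>_. \<bar>c\<bar> ^ DIM('a))) f"
      using f by (subst lborel_affine[OF c, of t, symmetric])
    then have "integrable lborel (\<lambda>x. \<bar>c\<bar> ^ DIM('a) *\<^sub>R f (t + c *\<^sub>R x))"
      using borel_measurable_integrable[OF f] c
      by (subst (asm) integrable_density) (auto simp: integrable_distr_eq)
    from integrable_scaleR_right[OF this, of "inverse (\<bar>c\<bar> ^ DIM('a))"] show ?thesis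
      using c by simp
  qed
  show iff: "integrable lborel (\<lambda>x. f (t + c *\<^sub>R x)) \<longleftrightarrow> integrable lborel f"
    using imp[of f c t] imp[of "\<lambda>x. f (t + c *\<^sub>R x)" "1/c" "- (1/c) *\<^sub>R t"] c
    by (auto simp: algebra_simps)
  show "(\<integral>x. f x \<partial>lborel) = \<bar>c\<bar> ^ DIM('a) *\<^sub>R (\<integral>x. f (t + c *\<^sub>R x) \<partial>lborel)"
  proof (cases "integrable lborel f")
    case True
    then show ?thesis
      using c borel_measurable_integrable[OF True]
      by (subst lborel_affine[OF c, of t], subst integral_density) (auto simp: integral_distr)
  next
    case False
    with iff show ?thesis by (simp add: not_integrable_integral_eq)
  qed
qed

lemma lborel_translation: "distr lborel borel ((+) t) = (lborel :: 'a::euclidean_space measure)"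
  using lborel_affine[of 1 t] by (simp add: density_1)

text \<open>Uniqueness of Haar measure, tested against the unit ball, which is invariant.\<close>

lemma lborel_distr_orthogonal:
  fixes Q :: "'a::euclidean_space \<Rightarrow> 'a"
  assumes Q: "orthogonal_transformation Q"
  shows "distr lborel borel Q = lborel"
proof -
  let ?\<mu> = "distr lborel borel Q"
  let ?B = "ball 0 1 :: 'a set"
  have linQ: "linear Q" and normQ: "norm (Q x) = norm x" for x
    using Q by (auto simp: orthogonal_transformation)
  have contQ: "continuous_on UNIV Q" using linQ by (simp add: linear_continuous_on linear_conv_bounded_linear)
  have [measurable]: "Q \<in> borel \<rightarrow>\<^sub>M borel" by (rule borel_measurable_continuous_onI[OF contQ])
  obtain Q' where Q': "Q (Q' x) = x" for x
    using orthogonal_transformation_surj[OF Q] by (metis surjD)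
  have transl: "distr ?\<mu> borel ((+) x) = ?\<mu>" for x
  proof -
    have "distr ?\<mu> borel ((+) x) = distr (distr lborel borel ((+) (Q' x))) borel Q"
      by (simp add: distr_distr o_def linear_add[OF linQ] Q')
    then show ?thesis by (simp add: lborel_translation)
  qed
  have ballQ: "Q -` ?B = ?B" by (auto simp: normQ)
  have muB: "emeasure ?\<mu> ?B = emeasure lborel ?B" by (simp add: emeasure_distr ballQ)
  have B_fin: "emeasure lborel ?B \<noteq> \<infinity>" "emeasure lborel ?B \<noteq> 0"
    using emeasure_lborel_ball_finite[of 0 1] content_ball_pos[of 1 "0::'a"]
    by (auto simp: measure_def less_top)
  interpret \<mu>: sigma_finite_measure ?\<mu>
  proof
    show "\<exists>A. countable A \<and> A \<subseteq> sets ?\<mu> \<and> \<Union>A = space ?\<mu> \<and> (\<forall>a\<in>A. emeasure ?\<mu> a \<noteq> \<infinity>)"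
    proof (intro exI[of _ "range (\<lambda>n. ball 0 (real n))"] conjI ballI)
      show "\<Union>(range (\<lambda>n. ball 0 (real n))) = space ?\<mu>"
        by (auto simp: reals_Archimedean2)
      fix a :: "'a set" assume "a \<in> range (\<lambda>n. ball 0 (real n))"
      then obtain n where a: "a = ball 0 (real n)" by auto
      have "Q -` a = a" by (auto simp: a normQ)
      then show "emeasure ?\<mu> a \<noteq> \<infinity>"
        using emeasure_lborel_ball_finite[of 0 "real n"] by (simp add: emeasure_distr a less_top)
    qed auto
  qed
  interpret pair_sigma_finite ?\<mu> lborel ..
  have pair_sets: "borel_measurable (?\<mu> \<Otimes>\<^sub>M lborel) = borel_measurable (borel \<Otimes>\<^sub>M borel)"
    by (intro measurable_cong_sets sets_pair_measure_cong) auto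
  have [measurable]: "?B \<in> sets borel" by simp
  show ?thesis
  proof (rule measure_eqI)
    fix A :: "'a set" assume "A \<in> sets ?\<mu>"
    then have [measurable]: "A \<in> sets borel" by simp
    have "emeasure lborel ?B * emeasure ?\<mu> A
        = (\<integral>\<^sup>+x. \<integral>\<^sup>+y. indicator ?B x * indicator A y \<partial>?\<mu> \<partial>lborel)"
      by (simp add: nn_integral_cmult, subst nn_integral_multc) (auto intro!: borel_measurable_indicator)
    also have "\<dots> = (\<integral>\<^sup>+x. \<integral>\<^sup>+y. indicator ?B x * indicator A (x + y) \<partial>?\<mu> \<partial>lborel)"
    proof (rule nn_integral_cong)
      fix x
      have "(\<integral>\<^sup>+y. indicator ?B x * indicator A y \<partial>?\<mu>) =
         (\<integral>\<^sup>+y. indicator ?B x * indicator A y \<partial>distr ?\<mu> borel ((+) x))"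
        by (simp only: transl)
      also have "\<dots> = (\<integral>\<^sup>+y. indicator ?B x * indicator A (x + y) \<partial>?\<mu>)"
        by (subst nn_integral_distr) auto
      finally show "(\<integral>\<^sup>+y. indicator ?B x * indicator A y \<partial>?\<mu>) = (\<integral>\<^sup>+y. indicator ?B x * indicator A (x + y) \<partial>?\<mu>)" .
    qed
    also have "\<dots> = (\<integral>\<^sup>+y. \<integral>\<^sup>+x. indicator ?B x * indicator A (x + y) \<partial>lborel \<partial>?\<mu>)"
      by (rule Fubini', subst pair_sets) measurable
    also have "\<dots> = (\<integral>\<^sup>+y. \<integral>\<^sup>+x. indicator ?B (x - y) * indicator A x \<partial>lborel \<partial>?\<mu>)"
    proof (rule nn_integral_cong)
      fix y
      have "(\<integral>\<^sup>+x. indicator ?B (x - y) * indicator A x \<partial>lborel) =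
         (\<integral>\<^sup>+x. indicator ?B (x - y) * indicator A x \<partial>distr lborel borel ((+) y))"
        by (simp only: lborel_translation)
      also have "\<dots> = (\<integral>\<^sup>+x. indicator ?B x * indicator A (x + y) \<partial>lborel)"
        by (subst nn_integral_distr) (auto simp: add.commute)
      finally show "(\<integral>\<^sup>+x. indicator ?B x * indicator A (x + y) \<partial>lborel)
        = (\<integral>\<^sup>+x. indicator ?B (x - y) * indicator A x \<partial>lborel)" by simp
    qed
    also have "\<dots> = (\<integral>\<^sup>+x. \<integral>\<^sup>+y. indicator ?B (x - y) * indicator A x \<partial>?\<mu> \<partial>lborel)"
      by (rule Fubini'[symmetric], subst pair_sets) measurable
    also have "\<dots> = (\<integral>\<^sup>+x. emeasure lborel ?B * indicator A x \<partial>lborel)"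
    proof (rule nn_integral_cong)
      fix x
      have "(\<integral>\<^sup>+y. indicator ?B (x - y) \<partial>?\<mu>) = (\<integral>\<^sup>+y. indicator ((+) x ` ?B) y \<partial>?\<mu>)"
        by (intro nn_integral_cong) (auto simp: indicator_def dist_norm norm_minus_commute)
      also have "\<dots> = (\<integral>\<^sup>+y. indicator ((+) x ` ?B) y \<partial>distr ?\<mu> borel ((+) x))"
        by (simp only: transl)
      also have "\<dots> = (\<integral>\<^sup>+y. indicator ((+) x ` ?B) (x + y) \<partial>?\<mu>)"
        by (subst nn_integral_distr) (auto intro!: borel_measurable_indicator simp: image_add_ball)
      also have "\<dots> = (\<integral>\<^sup>+y. indicator ?B y \<partial>?\<mu>)"
        by (intro nn_integral_cong) (auto simp: indicator_def dist_norm)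
      also have "\<dots> = emeasure lborel ?B" by (simp add: muB)
      finally show "(\<integral>\<^sup>+y. indicator ?B (x - y) * indicator A x \<partial>?\<mu>) = emeasure lborel ?B * indicator A x"
        by (simp add: nn_integral_multc)
    qed
    also have "\<dots> = emeasure lborel ?B * emeasure lborel A" by (simp add: nn_integral_cmult)
    finally show "emeasure ?\<mu> A = emeasure lborel A"
      using B_fin by (simp add: ennreal_mult_cancel_left)
  qed simp
qed

lemma lborel_integral_orthogonal:
  fixes f :: "'a::euclidean_space \<Rightarrow> 'b :: {banach, second_countable_topology}" and Q :: "'a \<Rightarrow> 'a"
  assumes Q: "orthogonal_transformation Q" and [measurable]: "f \<in> borel_measurable borel"
  shows "(\<integral>x. f (Q x) \<partial>lborel) = (\<integral>x. f x \<partial>lborel)"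
proof -
  have "linear Q" using Q by (simp add: orthogonal_transformation)
  then have [measurable]: "Q \<in> borel \<rightarrow>\<^sub>M borel"
    by (intro borel_measurable_continuous_onI) (simp add: linear_continuous_on linear_conv_bounded_linear)
  have "(\<integral>x. f x \<partial>lborel) = (\<integral>x. f x \<partial>distr lborel borel Q)"
    by (simp add: lborel_distr_orthogonal[OF Q])
  then show ?thesis by (simp add: integral_distr)
qed

lemma gaussian_has_bochner_integral_real:
  assumes c: "c > 0"
  shows "has_bochner_integral lborel (\<lambda>x::real. exp (- c * x\<^sup>2)) (sqrt (pi / c))"
proof -
  have "has_bochner_integral lborel (\<lambda>x::real. exp (- x\<^sup>2)) (2 * (sqrt pi / 2))"
    using has_bochner_integral_even_function[OF gaussian_moment_0] by simp
  then have "has_bochner_integral lborel (\<lambda>x::real. exp (- (0 + sqrt c * x)\<^sup>2)) (2 * (sqrt pi / 2) /\<^sub>R \<bar>sqrt c\<bar>)"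
    using c by (subst lborel_has_bochner_integral_real_affine_iff[symmetric]) auto
  then show ?thesis using c by (simp add: power_mult_distrib real_sqrt_divide field_simps)
qed

lemma gaussian_real:
  assumes c: "c > 0"
  shows "has_bochner_integral lborel (\<lambda>x::'a::euclidean_space. exp (- c * (norm x)\<^sup>2)) ((pi / c) powr (real DIM('a) / 2))"
proof (rule has_bochner_integral_nn_integral)
  have eq: "ennreal (exp (- c * (norm x)\<^sup>2)) = (\<Prod>b\<in>Basis. ennreal (exp (- c * (x \<bullet> b)\<^sup>2)))" for x :: 'a
  proof -
    have "(norm x)\<^sup>2 = (\<Sum>b\<in>Basis. (x \<bullet> b)\<^sup>2)"
      by (subst power2_norm_eq_inner, subst euclidean_inner) (simp add: power2_eq_square)
    then have "exp (- c * (norm x)\<^sup>2) = (\<Prod>b\<in>Basis. exp (- c * (x \<bullet> b)\<^sup>2))"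
      by (simp only: sum_distrib_left exp_sum finite_Basis)
    then show ?thesis by (simp add: prod_ennreal)
  qed
  have "(\<integral>\<^sup>+x. ennreal (exp (- c * (norm (x::'a))\<^sup>2)) \<partial>lborel) =
     (\<integral>\<^sup>+x. (\<Prod>b\<in>(Basis::'a set). ennreal (exp (- c * (x \<bullet> b)\<^sup>2))) \<partial>lborel)"
    by (simp only: eq)
  also have "\<dots> = (\<Prod>b\<in>(Basis::'a set). \<integral>\<^sup>+x. ennreal (exp (- c * x\<^sup>2)) \<partial>lborel)"
    by (rule nn_integral_lborel_prod) auto
  also have "(\<integral>\<^sup>+x. ennreal (exp (- c * x\<^sup>2)) \<partial>lborel) = ennreal (sqrt (pi / c))"
    using gaussian_has_bochner_integral_real[OF c]
    by (subst nn_integral_eq_integral) (auto simp: has_bochner_integral_iff)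
  also have "(\<Prod>b\<in>(Basis::'a set). ennreal (sqrt (pi / c))) = ennreal ((pi / c) powr (real DIM('a) / 2))"
    using c by (simp add: ennreal_power powr_half_sqrt[symmetric] powr_realpow[symmetric] powr_powr)
  finally show "(\<integral>\<^sup>+x. ennreal (exp (- c * (norm (x::'a))\<^sup>2)) \<partial>lborel) = ennreal ((pi / c) powr (real DIM('a) / 2))" .
qed auto

lemma gaussian_integrable [simp]:
  "c > 0 \<Longrightarrow> integrable lborel (\<lambda>x::'a::euclidean_space. exp (- c * (norm x)\<^sup>2))"
  using gaussian_real[where 'a = 'a, of c] by (auto simp: has_bochner_integral_iff)

lemma gaussian_second_moment_integrable:
  assumes c: "c > 0"
  shows "integrable lborel (\<lambda>x::'a::euclidean_space. exp (- c * (norm x)\<^sup>2) * (norm x)\<^sup>2)"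
proof -
  have le: "exp (- c * r) * r \<le> 2 / c * exp (- (c/2) * r)" for r :: real
  proof -
    have "(c/2) * r \<le> exp ((c/2) * r)" using exp_ge_add_one_self[of "(c/2) * r"] by linarith
    then have "exp (- c * r) * ((c/2) * r) \<le> exp (- c * r) * exp ((c/2) * r)"
      by (intro mult_left_mono) auto
    also have "\<dots> = exp (- (c/2) * r)" by (simp add: exp_add[symmetric])
    finally show ?thesis using c by (simp add: field_simps)
  qed
  have "integrable lborel (\<lambda>x::'a. 2 / c * exp (- (c/2) * (norm x)\<^sup>2))"
    using c by (intro integrable_mult_right gaussian_integrable) auto
  then show ?thesis
    by (rule Bochner_Integration.integrable_bound) (use c le in \<open>auto intro!: AE_I2\<close>)
qed

lemma complex_gaussian_integrable:
  assumes w: "Re w > 0"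
  shows "integrable lborel (\<lambda>x::'a::euclidean_space. exp (- w * of_real ((norm x)\<^sup>2)))"
  by (rule Bochner_Integration.integrable_bound[OF gaussian_integrable[OF w]])
    (auto intro!: AE_I2)

lemma complex_gaussian_holomorphic:
  "(\<lambda>w. \<integral>x. exp (- w * of_real ((norm x)\<^sup>2)) \<partial>(lborel :: 'a::euclidean_space measure)) holomorphic_on {w. Re w > 0}"
proof (rule holomorphic_onI)
  let ?f = "\<lambda>w (x::'a). exp (- w * of_real ((norm x)\<^sup>2))"
  fix w :: complex assume "w \<in> {w. Re w > 0}"
  then have w: "Re w > 0" by simp
  define c where "c = Re w / 2"
  have c: "c > 0" using w by (simp add: c_def)
  define D where "D x = - of_real ((norm x)\<^sup>2) * ?f w x" for x
  have ders: "((\<lambda>z. ?f z x) has_field_derivative - of_real ((norm x)\<^sup>2) * ?f z x) (at z within S)" for z x S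
    by (auto intro!: derivative_eq_intros)
  have bound: "norm ((?f (w + h) x - ?f w x) / h) \<le> exp (- c * (norm x)\<^sup>2) * (norm x)\<^sup>2"
    if h: "norm h < c" for h x
  proof -
    have "norm (?f (w + h) x - ?f w x) \<le> ((norm x)\<^sup>2 * exp (- c * (norm x)\<^sup>2)) * norm (w + h - w)"
    proof (rule field_differentiable_bound[where S = "{z. Re z \<ge> c}"])
      show "convex {z. Re z \<ge> c}" by (rule convex_halfspace_Re_ge)
      fix z assume "z \<in> {z. Re z \<ge> c}"
      then have "exp (- (Re z * (norm x)\<^sup>2)) \<le> exp (- (c * (norm x)\<^sup>2))"
        by (simp add: mult_right_mono)
      then show "norm (- of_real ((norm x)\<^sup>2) * ?f z x) \<le> (norm x)\<^sup>2 * exp (- c * (norm x)\<^sup>2)"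
        by (simp add: norm_mult norm_power mult_left_mono del: exp_le_cancel_iff)
      show "((\<lambda>z. ?f z x) has_field_derivative - of_real ((norm x)\<^sup>2) * ?f z x) (at z within {z. Re z \<ge> c})"
        by (rule ders)
    next
      have "\<bar>Re h\<bar> < c" using h abs_Re_le_cmod[of h] by linarith
      then show "w + h \<in> {z. Re z \<ge> c}" "w \<in> {z. Re z \<ge> c}" by (auto simp: c_def)
    qed
    then show ?thesis using c by (cases "h = 0") (auto simp: norm_divide field_simps)
  qed
  have "((\<lambda>w. \<integral>x. ?f w x \<partial>lborel) has_field_derivative (\<integral>x. D x \<partial>lborel)) (at w)"
    unfolding DERIV_def tendsto_at_iff_sequentially
  proof (intro allI impI)
    fix X :: "nat \<Rightarrow> complex" assume X: "\<forall>i. X i \<in> UNIV - {0}" "X \<longlonglongrightarrow> 0"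
    obtain N where N: "\<And>n. n \<ge> N \<Longrightarrow> norm (X n) < c"
      using X(2) c by (metis LIMSEQ_iff diff_zero)
    have lim: "(\<lambda>n. (?f (w + X (n + N)) x - ?f w x) / X (n + N)) \<longlonglongrightarrow> D x" for x
    proof -
      have "filterlim (\<lambda>n. X (n + N)) (at 0) sequentially"
        using X LIMSEQ_ignore_initial_segment[OF X(2), of N] by (auto simp: filterlim_at)
      moreover have "((\<lambda>h. (?f (w + h) x - ?f w x) / h) \<longlongrightarrow> D x) (at 0)"
        using ders[of x w UNIV] unfolding DERIV_def D_def by simp
      ultimately show ?thesis by (rule filterlim_compose[rotated])
    qed
    have "(\<lambda>n. \<integral>x. (?f (w + X (n + N)) x - ?f w x) / X (n + N) \<partial>lborel) \<longlonglongrightarrow> (\<integral>x. D x \<partial>lborel)"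
    proof (rule integral_dominated_convergence)
      show "integrable lborel (\<lambda>x::'a. exp (- c * (norm x)\<^sup>2) * (norm x)\<^sup>2)"
        by (rule gaussian_second_moment_integrable[OF c])
      show "AE x in lborel. norm ((?f (w + X (n + N)) x - ?f w x) / X (n + N)) \<le> exp (- c * (norm x)\<^sup>2) * (norm x)\<^sup>2" for n
        using bound N by simp
      show "AE x in lborel. (\<lambda>n. (?f (w + X (n + N)) x - ?f w x) / X (n + N)) \<longlonglongrightarrow> D x"
        using lim by simp
    qed (simp_all add: D_def)
    moreover have "(\<integral>x. (?f (w + X (n + N)) x - ?f w x) / X (n + N) \<partial>lborel)
        = ((\<integral>x. ?f (w + X (n + N)) x \<partial>lborel) - (\<integral>x. ?f w x \<partial>lborel)) / X (n + N)" for n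
    proof -
      have "\<bar>Re (X (n + N))\<bar> < c" using N[of "n + N"] abs_Re_le_cmod[of "X (n + N)"] by simp
      then have "Re (w + X (n + N)) > 0" by (auto simp: c_def)
      then show ?thesis
        by (simp only: integral_divide_zero Bochner_Integration.integral_diff complex_gaussian_integrable w)
    qed
    ultimately have "(\<lambda>n. ((\<lambda>h. ((\<integral>x. ?f (w + h) x \<partial>lborel) - (\<integral>x. ?f w x \<partial>lborel)) / h) \<circ> X) (n + N)) \<longlonglongrightarrow> (\<integral>x. D x \<partial>lborel)"
      by (simp only: o_def)
    then show "((\<lambda>h. ((\<integral>x. ?f (w + h) x \<partial>lborel) - (\<integral>x. ?f w x \<partial>lborel)) / h) \<circ> X) \<longlonglongrightarrow> (\<integral>x. D x \<partial>lborel)"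
      by (rule LIMSEQ_offset)
  qed
  then show "(\<lambda>w. \<integral>x. ?f w x \<partial>lborel) field_differentiable at w within {w. Re w > 0}"
    by (meson field_differentiable_at_within field_differentiable_def)
qed

lemma complex_gaussian_integral:
  assumes w: "Re w > 0"
  shows "(\<integral>x. exp (- w * of_real ((norm x)\<^sup>2)) \<partial>(lborel :: 'a::euclidean_space measure))
    = exp (of_real (real DIM('a) / 2) * Ln (of_real pi / w))"
proof -
  let ?F = "\<lambda>w. \<integral>x. exp (- w * of_real ((norm x)\<^sup>2)) \<partial>(lborel :: 'a measure)"
  let ?G = "\<lambda>w. exp (of_real (real DIM('a) / 2) * Ln (of_real pi / w))"
  have nonpos: "of_real pi / z \<notin> \<real>\<^sub>\<le>\<^sub>0" "z \<noteq> 0" if "Re z > 0" for z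
  proof -
    have "Re (of_real pi / z) = pi * Re z / (cmod z)\<^sup>2" by (simp add: Re_divide cmod_power2)
    moreover show "z \<noteq> 0" using that by auto
    ultimately have "Re (of_real pi / z) > 0" using that by simp
    then show "of_real pi / z \<notin> \<real>\<^sub>\<le>\<^sub>0" by (auto simp: complex_nonpos_Reals_iff)
  qed
  have "?F w - ?G w = 0"
  proof (rule analytic_continuation[where f = "\<lambda>w. ?F w - ?G w" and S = "{w. Re w > 0}"
        and U = "of_real ` {1<..}" and \<xi> = 1])
    show "(\<lambda>w. ?F w - ?G w) holomorphic_on {w. Re w > 0}"
      by (intro holomorphic_intros complex_gaussian_holomorphic) (use nonpos in auto)
    show "open {w. Re w > 0}" by (rule open_halfspace_Re_gt)
    show "connected {w. Re w > 0}" by (intro convex_connected convex_halfspace_Re_gt)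
    show "(1::complex) islimpt of_real ` {1<..}"
      unfolding islimpt_approachable
    proof (intro allI impI)
      fix e :: real assume "e > 0"
      then show "\<exists>x'\<in>of_real ` {1<..}. x' \<noteq> (1::complex) \<and> dist x' 1 < e"
        by (intro bexI[of _ "of_real (1 + e/2)"] image_eqI[of _ _ "1 + e/2"]) (auto simp: dist_norm)
    qed
    fix z :: complex assume "z \<in> of_real ` {1<..}"
    then obtain c :: real where z: "z = of_real c" and c: "c > 1" by auto
    have "?F z = of_real (\<integral>x. exp (- c * (norm x)\<^sup>2) \<partial>(lborel :: 'a measure))"
      unfolding z integral_complex_of_real[symmetric] by (simp only: exp_of_real of_real_mult[symmetric] of_real_minus[symmetric])
    also have "(\<integral>x. exp (- c * (norm x)\<^sup>2) \<partial>(lborel :: 'a measure)) = (pi / c) powr (real DIM('a) / 2)"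
      using gaussian_real[of c] c by (auto simp: has_bochner_integral_iff)
    also have "of_real \<dots> = ?G z"
      using c by (simp add: z powr_def exp_of_real Ln_of_real flip: of_real_mult of_real_divide)
    finally show "?F z - ?G z = 0" by simp
  qed (use w in auto)
  then show ?thesis by simp
qed

section \<open>Functions of matrices\<close>

definition conj_diag :: "complex^'n^'n \<Rightarrow> ('n \<Rightarrow> complex) \<Rightarrow> complex^'n^'n" where
  "conj_diag Y m = Y ** diag_mat m ** matrix_inv Y"

lemma conj_diag_entry: "conj_diag Y m $ i $ j = (\<Sum>k\<in>UNIV. Y $ i $ k * m k * matrix_inv Y $ k $ j)"
  by (simp add: conj_diag_def matrix_matrix_mult_def[of "Y ** diag_mat m"] diag_mat_mult_right)

lemma conj_diag_vector: "conj_diag Y m *v v = Y *v (\<chi> k. m k * (matrix_inv Y *v v) $ k)"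
proof -
  have "diag_mat m *v w = (\<chi> k. m k * w $ k)" for w
    by (simp add: vec_eq_iff diag_mat_def matrix_vector_mult_def if_distrib if_distribR cong: if_cong)
  then show ?thesis by (simp add: conj_diag_def matrix_vector_mul_assoc[symmetric])
qed

lemma conj_diag_linear:
  "conj_diag Y (\<lambda>k. m k - n k) = conj_diag Y m - conj_diag Y n"
  "conj_diag Y (\<lambda>k. - m k) = - conj_diag Y m"
  "conj_diag Y (\<lambda>k. of_real r * m k) = r *\<^sub>R conj_diag Y m"
  by (simp_all add: vec_eq_iff conj_diag_entry algebra_simps sum.distrib sum_subtractf sum_negf
      scaleR_conv_of_real[where 'a = complex] sum_distrib_left)

lemma diagonalizes_conj_diag:
  assumes "diagonalizes Y A" obtains l where "invertible Y" "A = conj_diag Y l"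
proof -
  from assms obtain l where Y: "invertible Y" and l: "matrix_inv Y ** A ** Y = diag_mat l"
    by (auto simp: diagonalizes_def)
  have "conj_diag Y l = (Y ** matrix_inv Y) ** A ** (Y ** matrix_inv Y)"
    by (simp add: conj_diag_def l[symmetric] matrix_mul_assoc)
  then have "A = conj_diag Y l" by (simp add: matrix_inv_both[OF Y])
  with that Y show thesis by metis
qed

context
  fixes Y :: "complex^'n^'n" assumes Y: "invertible Y"
begin

lemma conj_diag_mult: "conj_diag Y m ** conj_diag Y n = conj_diag Y (\<lambda>k. m k * n k)"
proof -
  have "diag_mat m ** diag_mat n = diag_mat (\<lambda>k. m k * n k)"
    by (simp add: vec_eq_iff diag_mat_mult_left) (simp add: diag_mat_def)
  moreover have "conj_diag Y m ** conj_diag Y n = Y ** diag_mat m ** (matrix_inv Y ** Y) ** diag_mat n ** matrix_inv Y"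
    by (simp add: conj_diag_def matrix_mul_assoc)
  ultimately show ?thesis
    by (simp add: conj_diag_def matrix_inv_both[OF Y] matrix_mul_assoc[symmetric])
qed

lemma conj_diag_one: "conj_diag Y (\<lambda>k. 1) = mat 1"
proof -
  have "diag_mat (\<lambda>k. 1) = (mat 1 :: complex^'n^'n)" by (simp add: vec_eq_iff diag_mat_def mat_def)
  then show ?thesis by (simp add: conj_diag_def matrix_inv_both[OF Y])
qed

lemma conj_diag_pow: "mat_pow (conj_diag Y m) k = conj_diag Y (\<lambda>i. m i ^ k)"
  by (induction k) (simp_all add: conj_diag_one conj_diag_mult)

lemma conj_diag_exp: "mat_exp (conj_diag Y m) = conj_diag Y (\<lambda>i. exp (m i))"
proof -
  have "(\<lambda>k. mat_pow (conj_diag Y m) k /\<^sub>R fact k) sums conj_diag Y (\<lambda>i. exp (m i))"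
    unfolding sums_def
  proof (intro vec_tendstoI)
    fix i j
    have "(\<lambda>k. \<Sum>l\<in>UNIV. Y $ i $ l * (m l ^ k /\<^sub>R fact k) * matrix_inv Y $ l $ j) sums
        (\<Sum>l\<in>UNIV. Y $ i $ l * exp (m l) * matrix_inv Y $ l $ j)"
      by (intro sums_sum sums_mult sums_mult2 exp_converges)
    then show "(\<lambda>n. (\<Sum>k<n. mat_pow (conj_diag Y m) k /\<^sub>R fact k) $ i $ j) \<longlonglongrightarrow> conj_diag Y (\<lambda>i. exp (m i)) $ i $ j"
      by (simp add: sums_def conj_diag_pow conj_diag_entry scaleR_sum_right)
  qed
  then show ?thesis by (simp add: mat_exp_def sums_iff)
qed

lemma conj_diag_powr: "mat_powr (conj_diag Y m) s = conj_diag Y (\<lambda>k. exp (s * Ln (m k)))"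
  using mat_powr_eq[OF Y, of "conj_diag Y m" m s] by (simp add: conj_diag_def)

lemma conj_diag_inv: assumes "\<And>k. m k \<noteq> 0" shows "matrix_inv (conj_diag Y m) = conj_diag Y (\<lambda>k. 1 / m k)"
proof -
  have *: "conj_diag Y m ** conj_diag Y (\<lambda>k. 1 / m k) = mat 1" "conj_diag Y (\<lambda>k. 1 / m k) ** conj_diag Y m = mat 1"
    using assms by (simp_all add: conj_diag_mult conj_diag_one)
  then have "invertible (conj_diag Y m)" by (auto simp: invertible_def)
  from matrix_inv_both(1)[OF this] have "conj_diag Y (\<lambda>k. 1 / m k) ** (conj_diag Y m ** matrix_inv (conj_diag Y m)) = conj_diag Y (\<lambda>k. 1 / m k)"
    by simp
  then show ?thesis by (simp add: matrix_mul_assoc *)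
qed

lemma conj_diag_spectrum: "spectrum (conj_diag Y m) = range m"
proof (intro set_eqI iffI)
  fix \<mu> assume "\<mu> \<in> spectrum (conj_diag Y m)"
  then obtain v where v: "v \<noteq> 0" "conj_diag Y m *v v = \<mu> *s v" by (auto simp: spectrum_def)
  define w where "w = matrix_inv Y *v v"
  have vw: "v = Y *v w" by (simp add: w_def matrix_vector_mul_assoc matrix_inv_both[OF Y])
  with v have "w \<noteq> 0" by auto
  then obtain k where k: "w $ k \<noteq> 0" by (auto simp: vec_eq_iff)
  have "(\<chi> k. m k * w $ k) = matrix_inv Y *v (conj_diag Y m *v v)"
    by (simp add: conj_diag_vector w_def matrix_vector_mul_assoc matrix_inv_both[OF Y])
  also have "\<dots> = \<mu> *s w" by (simp add: v(2) w_def vector_scalar_commute)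
  finally have "m k * w $ k = \<mu> * w $ k" by (simp add: vec_eq_iff)
  with k show "\<mu> \<in> range m" by auto
next
  fix \<mu> assume "\<mu> \<in> range m"
  then obtain k where k: "\<mu> = m k" by auto
  let ?e = "axis k 1 :: complex^'n"
  have inv: "matrix_inv Y *v (Y *v ?e) = ?e" by (simp add: matrix_vector_mul_assoc matrix_inv_both[OF Y])
  have "Y *v ?e \<noteq> 0" using inv by (metis matrix_vector_mult_0_right axis_eq_0_iff zero_neq_one)
  moreover have "conj_diag Y m *v (Y *v ?e) = \<mu> *s (Y *v ?e)"
  proof -
    have "(\<chi> l. m l * ?e $ l) = \<mu> *s ?e" by (simp add: vec_eq_iff axis_def k)
    then show ?thesis by (simp add: conj_diag_vector inv vector_scalar_commute)
  qed
  ultimately show "\<mu> \<in> spectrum (conj_diag Y m)" by (auto simp: spectrum_def)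
qed

lemma conj_diag_norm:
  assumes "\<And>k. norm (m k) \<le> c"
  shows "norm (conj_diag Y m *v v) \<le> cond_number Y * c * norm v"
proof -
  let ?w = "matrix_inv Y *v v"
  have on: "norm (Z *v x) \<le> spectral_norm Z * norm x" "spectral_norm Z \<ge> 0" for Z :: "complex^'n^'n" and x
    unfolding spectral_norm_def by (simp_all add: onorm onorm_pos_le)
  have c: "c \<ge> 0" using assms norm_ge_zero order_trans by blast
  have "norm (\<chi> k. m k * ?w $ k) \<le> c * norm ?w"
  proof -
    have "norm (\<chi> k. m k * ?w $ k) \<le> L2_set (\<lambda>k. c * norm (?w $ k)) UNIV"
      unfolding norm_vec_def by (intro L2_set_mono) (auto simp: norm_mult assms mult_right_mono)
    also have "\<dots> = c * norm ?w" by (simp add: norm_vec_def L2_set_right_distrib c)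
    finally show ?thesis .
  qed
  then have "norm (conj_diag Y m *v v) \<le> spectral_norm Y * (c * norm ?w)"
    unfolding conj_diag_vector by (meson on mult_left_mono order_trans)
  also have "\<dots> \<le> spectral_norm Y * (c * (spectral_norm (matrix_inv Y) * norm v))"
    by (intro mult_left_mono on c)
  finally show ?thesis by (simp add: cond_number_def mult_ac)
qed

lemma cond_number_nonneg: "cond_number Y \<ge> 0"
  unfolding cond_number_def spectral_norm_def by (simp add: onorm_pos_le)

end

lemma mat_pow_commute: "mat_pow M k ** M = M ** mat_pow M k"
  by (induction k) (simp_all add: matrix_mul_assoc[symmetric])

lemma transpose_mat_pow:
  fixes M :: "'a::comm_semiring_1^'n^'n"
  shows "transpose (mat_pow M k) = mat_pow (transpose M) k"
  by (induction k) (simp_all add: matrix_transpose_mul mat_pow_commute)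

lemma mat_pow_scaleR: "mat_pow (t *\<^sub>R (M::real^'n^'n)) k = t ^ k *\<^sub>R mat_pow M k"
  by (induction k) (simp_all add: matrix_scalar_ac scalar_matrix_assoc mult_ac)

context
  fixes S :: "real^'d^'d"
begin

definition "exp_coeff i j k = mat_pow S k $ i $ j / fact k"

lemma exp_coeff_bound: "\<bar>mat_pow S k $ i $ j\<bar> \<le> (\<Sum>a\<in>UNIV. \<Sum>b\<in>UNIV. \<bar>S $ a $ b\<bar>) ^ k"
proof (induction k arbitrary: i j)
  case 0 then show ?case by (simp add: mat_def)
next
  case (Suc k)
  let ?c = "\<Sum>a\<in>UNIV. \<Sum>b\<in>UNIV. \<bar>S $ a $ b\<bar>"
  have c: "?c \<ge> 0" by (intro sum_nonneg) auto
  have "\<bar>mat_pow S (Suc k) $ i $ j\<bar> \<le> (\<Sum>l\<in>UNIV. \<bar>S $ i $ l * mat_pow S k $ l $ j\<bar>)"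
    by (simp add: matrix_matrix_mult_def)
  also have "\<dots> \<le> (\<Sum>l\<in>UNIV. \<bar>S $ i $ l\<bar> * ?c ^ k)"
    by (intro sum_mono) (auto simp: abs_mult intro!: mult_left_mono Suc)
  also have "\<dots> = (\<Sum>l\<in>UNIV. \<bar>S $ i $ l\<bar>) * ?c ^ k" by (simp add: sum_distrib_right)
  also have "\<dots> \<le> ?c * ?c ^ k"
    using c by (intro mult_right_mono member_le_sum[of i UNIV "\<lambda>a. \<Sum>b\<in>UNIV. \<bar>S $ a $ b\<bar>"])
      (auto intro!: sum_nonneg)
  finally show ?case by simp
qed

lemma exp_coeff_summable: "summable (\<lambda>k. exp_coeff i j k * t ^ k)"
proof (rule summable_comparison_test)
  let ?c = "\<Sum>a\<in>UNIV. \<Sum>b\<in>UNIV. \<bar>S $ a $ b\<bar>"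
  show "summable (\<lambda>k. (?c * \<bar>t\<bar>) ^ k /\<^sub>R fact k)" by (rule summable_exp_generic)
  show "\<exists>N. \<forall>k\<ge>N. norm (exp_coeff i j k * t ^ k) \<le> (?c * \<bar>t\<bar>) ^ k /\<^sub>R fact k"
  proof (intro exI allI impI)
    fix k
    have "\<bar>mat_pow S k $ i $ j\<bar> * \<bar>t\<bar> ^ k / fact k \<le> ?c ^ k * \<bar>t\<bar> ^ k / fact k"
      by (intro divide_right_mono mult_right_mono exp_coeff_bound) auto
    then show "norm (exp_coeff i j k * t ^ k) \<le> (?c * \<bar>t\<bar>) ^ k /\<^sub>R fact k"
      by (simp add: exp_coeff_def abs_mult power_abs power_mult_distrib divide_inverse mult_ac)
  qed
qed

lemma mat_exp_entry: "mat_exp (t *\<^sub>R S) $ i $ j = (\<Sum>k. exp_coeff i j k * t ^ k)"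
proof -
  have "(\<lambda>k. mat_pow (t *\<^sub>R S) k /\<^sub>R fact k) sums (\<chi> i j. \<Sum>k. exp_coeff i j k * t ^ k)"
    unfolding sums_def
  proof (intro vec_tendstoI)
    fix i j
    show "(\<lambda>n. (\<Sum>k<n. mat_pow (t *\<^sub>R S) k /\<^sub>R fact k) $ i $ j) \<longlonglongrightarrow> (\<chi> i j. \<Sum>k. exp_coeff i j k * t ^ k) $ i $ j"
      using summable_LIMSEQ[OF exp_coeff_summable[of i j t]]
      by (simp add: mat_pow_scaleR exp_coeff_def divide_inverse mult_ac)
  qed
  then show ?thesis by (simp add: mat_exp_def sums_iff)
qed

lemma mat_exp_zero: "mat_exp (0 *\<^sub>R S) = mat 1"
proof -
  have "(\<Sum>k. exp_coeff i j k * 0 ^ k) = mat 1 $ i $ j" for i j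
    using powser_zero[of "exp_coeff i j"] by (simp add: exp_coeff_def)
  then show ?thesis by (auto simp only: vec_eq_iff mat_exp_entry)
qed

lemma mat_exp_deriv:
  shows "((\<lambda>t. mat_exp (t *\<^sub>R S) $ i $ j) has_field_derivative (S ** mat_exp (t *\<^sub>R S)) $ i $ j) (at t within T)"
    and "S ** mat_exp (t *\<^sub>R S) = mat_exp (t *\<^sub>R S) ** S"
proof -
  have d: "diffs (exp_coeff i j) = (\<lambda>k. mat_pow S (Suc k) $ i $ j / fact k)" for i j
    by (simp add: diffs_def exp_coeff_def del: mat_pow.simps of_nat_Suc)
  have "(\<Sum>k. diffs (exp_coeff i j) k * t ^ k) = (S ** mat_exp (t *\<^sub>R S)) $ i $ j" for i j
  proof -
    have "(\<lambda>k. \<Sum>l\<in>UNIV. S $ i $ l * (exp_coeff l j k * t ^ k)) sums (\<Sum>l\<in>UNIV. S $ i $ l * mat_exp (t *\<^sub>R S) $ l $ j)"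
      unfolding mat_exp_entry by (intro sums_sum sums_mult summable_sums exp_coeff_summable)
    then show ?thesis
      by (simp add: sums_iff d matrix_matrix_mult_def exp_coeff_def sum_divide_distrib sum_distrib_right mult.assoc)
  qed
  note left = this
  have "(\<Sum>k. diffs (exp_coeff i j) k * t ^ k) = (mat_exp (t *\<^sub>R S) ** S) $ i $ j" for i j
  proof -
    have "(\<lambda>k. \<Sum>l\<in>UNIV. exp_coeff i l k * t ^ k * S $ l $ j) sums (\<Sum>l\<in>UNIV. mat_exp (t *\<^sub>R S) $ i $ l * S $ l $ j)"
      unfolding mat_exp_entry by (intro sums_sum sums_mult2 summable_sums exp_coeff_summable)
    then show ?thesis
      by (simp add: sums_iff d mat_pow_commute[symmetric])
        (simp add: matrix_matrix_mult_def exp_coeff_def sum_divide_distrib sum_distrib_right sum_distrib_left mult_ac)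
  qed
  with left show "S ** mat_exp (t *\<^sub>R S) = mat_exp (t *\<^sub>R S) ** S"
    by (simp add: vec_eq_iff)
  have "((\<lambda>t. \<Sum>k. exp_coeff i j k * t ^ k) has_field_derivative (\<Sum>k. diffs (exp_coeff i j) k * t ^ k)) (at t)"
    by (rule termdiffs_strong_converges_everywhere exp_coeff_summable)+
  then show "((\<lambda>t. mat_exp (t *\<^sub>R S) $ i $ j) has_field_derivative (S ** mat_exp (t *\<^sub>R S)) $ i $ j) (at t within T)"
    unfolding mat_exp_entry left by (rule DERIV_subset) auto
qed

lemma mat_exp_shift: "mat_exp (- t *\<^sub>R S) ** mat_exp ((s + t) *\<^sub>R S) = mat_exp (s *\<^sub>R S)"
proof -
  have "(mat_exp (- t *\<^sub>R S) ** mat_exp ((s + t) *\<^sub>R S)) $ i $ j = (mat_exp (- 0 *\<^sub>R S) ** mat_exp ((s + 0) *\<^sub>R S)) $ i $ j" for i j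
  proof (rule DERIV_isconst_all[where f = "\<lambda>t. (mat_exp (- t *\<^sub>R S) ** mat_exp ((s + t) *\<^sub>R S)) $ i $ j", rule_format])
    fix t
    let ?E = "\<lambda>t. mat_exp (t *\<^sub>R S)"
    have d1: "((\<lambda>t. ?E (- t) $ i $ l) has_field_derivative (S ** ?E (- t)) $ i $ l * (-1)) (at t)" for l
      by (rule DERIV_chain2[OF mat_exp_deriv(1)]) (auto intro!: derivative_eq_intros)
    have d2: "((\<lambda>t. ?E (s + t) $ l $ j) has_field_derivative (S ** ?E (s + t)) $ l $ j * 1) (at t)" for l
      by (rule DERIV_chain2[OF mat_exp_deriv(1)]) (auto intro!: derivative_eq_intros)
    have "((\<lambda>t. \<Sum>l\<in>UNIV. ?E (- t) $ i $ l * ?E (s + t) $ l $ j) has_field_derivative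
      (\<Sum>l\<in>UNIV. (S ** ?E (- t)) $ i $ l * (-1) * ?E (s + t) $ l $ j + (S ** ?E (s + t)) $ l $ j * 1 * ?E (- t) $ i $ l)) (at t)"
      by (intro DERIV_sum DERIV_mult d1 d2)
    also have "(\<Sum>l\<in>UNIV. (S ** ?E (- t)) $ i $ l * (-1) * ?E (s + t) $ l $ j + (S ** ?E (s + t)) $ l $ j * 1 * ?E (- t) $ i $ l)
      = - ((?E (- t) ** S) ** ?E (s + t)) $ i $ j + (?E (- t) ** (S ** ?E (s + t))) $ i $ j"
      unfolding mat_exp_deriv(2)[symmetric]
      by (simp add: sum.distrib sum_negf sum_subtractf matrix_matrix_mult_def[of "S ** _"] matrix_matrix_mult_def[of "mat_exp _"] mult_ac)
    also have "\<dots> = 0" by (simp add: matrix_mul_assoc)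
    finally show "((\<lambda>t. (?E (- t) ** ?E (s + t)) $ i $ j) has_field_derivative 0) (at t)"
      by (simp add: matrix_matrix_mult_def)
  qed
  then show ?thesis by (simp add: vec_eq_iff mat_exp_zero[simplified])
qed

lemma mat_exp_inverse: "mat_exp (- t *\<^sub>R S) ** mat_exp (t *\<^sub>R S) = mat 1"
  using mat_exp_shift[of t 0] by (simp add: mat_exp_zero[simplified])

lemma mat_exp_add: "mat_exp ((s + t) *\<^sub>R S) = mat_exp (t *\<^sub>R S) ** mat_exp (s *\<^sub>R S)"
proof -
  have "mat_exp (t *\<^sub>R S) ** mat_exp (s *\<^sub>R S) = (mat_exp (t *\<^sub>R S) ** mat_exp (- t *\<^sub>R S)) ** mat_exp ((s + t) *\<^sub>R S)"
    by (simp only: mat_exp_shift matrix_mul_assoc[symmetric])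
  then show ?thesis using mat_exp_inverse[of "- t"] by simp
qed

lemma mat_exp_orthogonal:
  assumes S: "transpose S = - S"
  shows "orthogonal_transformation ((*v) (mat_exp (t *\<^sub>R S)))"
proof -
  have neg: "mat_pow (- S) k = (-1) ^ k *\<^sub>R mat_pow S k" for k
    using mat_pow_scaleR[of "-1" S k] by simp
  have "mat_exp (t *\<^sub>R S) $ j $ i = mat_exp (- t *\<^sub>R S) $ i $ j" for i j
  proof -
    have "exp_coeff j i k * t ^ k = exp_coeff i j k * (- t) ^ k" for k
    proof -
      have "mat_pow S k $ j $ i = transpose (mat_pow S k) $ i $ j" by (simp add: transpose_def)
      also have "\<dots> = (-1) ^ k * mat_pow S k $ i $ j" by (simp add: transpose_mat_pow S neg)
      finally show ?thesis by (simp add: exp_coeff_def power_minus[of t])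
    qed
    then show ?thesis by (simp only: mat_exp_entry)
  qed
  then have "transpose (mat_exp (t *\<^sub>R S)) = mat_exp (- t *\<^sub>R S)"
    by (simp add: vec_eq_iff transpose_def)
  then have "orthogonal_matrix (mat_exp (t *\<^sub>R S))"
    using mat_exp_inverse[of t] by (simp add: orthogonal_matrix)
  then show ?thesis by (simp add: orthogonal_transformation_matrix)
qed

end

section \<open>The complex heat kernel\<close>

definition gauss_kernel :: "complex \<Rightarrow> 'a::euclidean_space \<Rightarrow> complex" where
  "gauss_kernel a z = exp (- of_nat DIM('a) / 2 * Ln (of_real (4 * pi) * a)) * exp (- of_real ((norm z)\<^sup>2) / (4 * a))"

lemma gauss_kernel_measurable [measurable]: "gauss_kernel a \<in> borel_measurable borel"
  unfolding gauss_kernel_def by measurable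

lemma gauss_kernel_norm_cong: "norm z = norm (w :: 'a::euclidean_space) \<Longrightarrow> gauss_kernel a (z :: 'a) = gauss_kernel a w"
  by (simp add: gauss_kernel_def)

lemma Re_inverse_4: assumes "Re a > 0" shows "Re (1 / (4 * a)) = Re a / (4 * (norm a)\<^sup>2)" "Re (1 / (4 * a)) > 0"
proof -
  have "a \<noteq> 0" using assms by auto
  moreover have "Re (1 / (4 * a)) = Re a / (4 * (norm a)\<^sup>2)"
  proof -
    have "1 / (4 * a) = (1 / a) / 4" by simp
    then have "Re (1 / (4 * a)) = Re (1 / a) / 4" by (simp only: Re_divide_numeral)
    also have "Re (1 / a) = Re a / (norm a)\<^sup>2" by (simp add: Re_divide cmod_power2)
    finally show ?thesis by simp
  qed
  ultimately show "Re (1 / (4 * a)) = Re a / (4 * (norm a)\<^sup>2)" "Re (1 / (4 * a)) > 0"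
    using assms by auto
qed

lemma gauss_kernel_integral:
  fixes a :: complex
  assumes a: "Re a > 0"
  shows "integrable lborel (gauss_kernel a :: 'a::euclidean_space \<Rightarrow> complex)"
    and "(\<integral>z. gauss_kernel a z \<partial>(lborel :: 'a measure)) = 1"
proof -
  let ?w = "1 / (4 * a)" and ?c = "exp (- of_nat DIM('a) / 2 * Ln (of_real (4 * pi) * a))"
  have eq: "gauss_kernel a = (\<lambda>z::'a. ?c * exp (- ?w * of_real ((norm z)\<^sup>2)))"
    by (simp add: gauss_kernel_def fun_eq_iff)
  have w: "Re ?w > 0" by (rule Re_inverse_4[OF a])
  show "integrable lborel (gauss_kernel a :: 'a \<Rightarrow> complex)"
    unfolding eq by (intro integrable_mult_right complex_gaussian_integrable w)
  have "(\<integral>z. gauss_kernel a z \<partial>(lborel :: 'a measure)) = ?c * exp (of_real (real DIM('a) / 2) * Ln (of_real pi / ?w))"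
    unfolding eq integral_mult_right_zero complex_gaussian_integral[OF w] ..
  also have "of_real pi / ?w = of_real (4 * pi) * a" by simp
  finally show "(\<integral>z. gauss_kernel a z \<partial>(lborel :: 'a measure)) = 1"
    by (simp add: exp_add[symmetric])
qed

lemma gauss_kernel_norm_le:
  fixes z :: "'a::euclidean_space"
  assumes "0 < a0" "a0 \<le> Re a" "0 < amin" "amin \<le> norm a" "norm a \<le> amax"
  shows "norm (gauss_kernel a z) \<le> (4 * pi * amin) powr (- real DIM('a) / 2) * exp (- (a0 / (4 * amax\<^sup>2)) * (norm z)\<^sup>2)"
proof -
  have a: "Re a > 0" "a \<noteq> 0" using assms by auto
  have "norm (exp (- of_nat DIM('a) / 2 * Ln (of_real (4 * pi) * a))) = (4 * pi * norm a) powr (- real DIM('a) / 2)"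
    using a by (simp add: powr_def norm_mult)
  also have "\<dots> \<le> (4 * pi * amin) powr (- real DIM('a) / 2)"
    using assms by (intro powr_mono2') auto
  finally have 1: "norm (exp (- of_nat DIM('a) / 2 * Ln (of_real (4 * pi) * a))) \<le> (4 * pi * amin) powr (- real DIM('a) / 2)" .
  have "a0 / (4 * amax\<^sup>2) \<le> Re a / (4 * (norm a)\<^sup>2)"
    using assms a by (intro frac_le mult_left_mono power_mono) auto
  then have "a0 / (4 * amax\<^sup>2) * (norm z)\<^sup>2 \<le> Re (1 / (4 * a)) * (norm z)\<^sup>2"
    by (simp only: Re_inverse_4[OF a(1)]) (intro mult_right_mono, auto)
  moreover have "Re (- of_real ((norm z)\<^sup>2) / (4 * a)) = - (Re (1 / (4 * a)) * (norm z)\<^sup>2)"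
  proof -
    have "- of_real ((norm z)\<^sup>2) / (4 * a) = of_real (- (norm z)\<^sup>2) * (1 / (4 * a))" by simp
    then show ?thesis by (simp only: times_complex.sel Re_complex_of_real Im_complex_of_real) simp
  qed
  ultimately have "norm (exp (- of_real ((norm z)\<^sup>2) / (4 * a))) \<le> exp (- (a0 / (4 * amax\<^sup>2)) * (norm z)\<^sup>2)"
    by (simp only: norm_exp_eq_Re exp_le_cancel_iff)
  with 1 show ?thesis unfolding gauss_kernel_def norm_mult by (intro mult_mono) auto
qed

text \<open>The exponent is unchanged by the rotation
  \<open>(z, w) \<mapsto> ((\<surd>t z + \<surd>s w) / \<surd>(t + s), \<dots>)\<close> of the product space.\<close>

lemma gauss_kernel_mult_rotate:
  fixes z y :: "'a::euclidean_space"
  assumes s: "s > 0" and t: "t \<ge> 0" and r: "r = sqrt (t + s)"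
  shows "gauss_kernel a z * gauss_kernel a (- (sqrt t / sqrt s) *\<^sub>R z + (r / sqrt s) *\<^sub>R y)
    = gauss_kernel a y * gauss_kernel a ((r / sqrt s) *\<^sub>R (z - (sqrt t / r) *\<^sub>R y))"
proof -
  have r2: "r\<^sup>2 = t + s" "r > 0" using s t by (auto simp: r)
  have sq: "(sqrt t)\<^sup>2 = t" "(sqrt s)\<^sup>2 = s" "sqrt s > 0" using s t by auto
  have "(norm z)\<^sup>2 + (norm (- (sqrt t / sqrt s) *\<^sub>R z + (r / sqrt s) *\<^sub>R y))\<^sup>2
    = (norm y)\<^sup>2 + (norm ((r / sqrt s) *\<^sub>R (z - (sqrt t / r) *\<^sub>R y)))\<^sup>2"
  proof -
    define p q u where "p = z \<bullet> z" and "q = z \<bullet> y" and "u = y \<bullet> y"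
    have gen: "(norm (\<alpha> *\<^sub>R z + \<beta> *\<^sub>R y))\<^sup>2 = \<alpha>\<^sup>2 * p + 2 * (\<alpha> * \<beta>) * q + \<beta>\<^sup>2 * u" for \<alpha> \<beta>
      by (simp add: power2_norm_eq_inner inner_simps p_def q_def u_def inner_commute[of y z])
        (simp add: power2_eq_square algebra_simps)
    have rs: "r / sqrt s * (sqrt t / r) = sqrt t / sqrt s" using r2 by simp
    have 1: "(norm (- (sqrt t / sqrt s) *\<^sub>R z + (r / sqrt s) *\<^sub>R y))\<^sup>2
        = (t / s) * p + 2 * (- (sqrt t / sqrt s) * (r / sqrt s)) * q + (r\<^sup>2 / s) * u"
      unfolding gen power2_minus power_divide sq ..
    have "(r / sqrt s) *\<^sub>R (z - (sqrt t / r) *\<^sub>R y) = (r / sqrt s) *\<^sub>R z + (- (sqrt t / sqrt s)) *\<^sub>R y"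
      by (simp add: scaleR_diff_right rs del: times_divide_eq_left times_divide_eq_right times_divide_times_eq)
    then have 2: "(norm ((r / sqrt s) *\<^sub>R (z - (sqrt t / r) *\<^sub>R y)))\<^sup>2
        = (r\<^sup>2 / s) * p + 2 * (- (sqrt t / sqrt s) * (r / sqrt s)) * q + (t / s) * u"
      by (simp only: gen power2_minus power_divide sq mult.commute[of "r / sqrt s"])
    show ?thesis unfolding 1 2 r2
      using s by (simp add: power2_norm_eq_inner p_def[symmetric] u_def[symmetric] field_simps)
  qed
  then have "- of_real ((norm z)\<^sup>2) / (4 * a) + - of_real ((norm (- (sqrt t / sqrt s) *\<^sub>R z + (r / sqrt s) *\<^sub>R y))\<^sup>2) / (4 * a)
    = - of_real ((norm y)\<^sup>2) / (4 * a) + - of_real ((norm ((r / sqrt s) *\<^sub>R (z - (sqrt t / r) *\<^sub>R y)))\<^sup>2) / (4 * a)"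
    unfolding add_divide_distrib[symmetric] minus_add_distrib[symmetric] of_real_add[symmetric] by simp
  moreover have "gauss_kernel a u * gauss_kernel a v = (exp (- of_nat DIM('a) / 2 * Ln (of_real (4 * pi) * a)))\<^sup>2
      * exp (- of_real ((norm u)\<^sup>2) / (4 * a) + - of_real ((norm v)\<^sup>2) / (4 * a))" for u v :: 'a
    by (simp only: gauss_kernel_def exp_add power2_eq_square mult_ac)
  ultimately show ?thesis by simp
qed

lemma gauss_kernel_convolution:
  fixes f :: "'a::euclidean_space \<Rightarrow> complex"
  assumes a: "Re a > 0" and s: "s > 0" and t: "t \<ge> 0"
    and [measurable]: "f \<in> borel_measurable borel" and f: "\<And>x. norm (f x) \<le> C"
  shows "(\<integral>z. gauss_kernel a z * (\<integral>w. gauss_kernel a w * f (sqrt t *\<^sub>R z + sqrt s *\<^sub>R w) \<partial>lborel) \<partial>lborel)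
    = (\<integral>y. gauss_kernel a y * f (sqrt (t + s) *\<^sub>R y) \<partial>lborel)"
proof -
  define r where "r = sqrt (t + s)"
  have r0: "r > 0" "sqrt s > 0" using s t by (auto simp: r_def)
  have rs: "r / sqrt s * (sqrt t / r) = sqrt t / sqrt s" using r0 by simp
  let ?K = "gauss_kernel a :: 'a \<Rightarrow> complex"
  let ?w = "\<lambda>z y :: 'a. - (sqrt t / sqrt s) *\<^sub>R z + (r / sqrt s) *\<^sub>R y"
  let ?u = "\<lambda>z y :: 'a. (r / sqrt s) *\<^sub>R (z - (sqrt t / r) *\<^sub>R y)"
  define c where "c = \<bar>r / sqrt s\<bar> ^ DIM('a)"
  have c: "c > 0" using r0 by (simp add: c_def)
  have int_u: "integrable lborel (\<lambda>z. ?K (?u z y))" and val_u: "c *\<^sub>R (\<integral>z. ?K (?u z y) \<partial>lborel) = 1" for y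
  proof -
    have *: "?u z y = - (sqrt t / sqrt s) *\<^sub>R y + (r / sqrt s) *\<^sub>R z" for z :: 'a
      by (simp add: scaleR_diff_right rs del: times_divide_eq_left times_divide_eq_right times_divide_times_eq)
    show "integrable lborel (\<lambda>z. ?K (?u z y))"
      unfolding * using r0 gauss_kernel_integral(1)[OF a] by (subst lborel_integral_affine) auto
    show "c *\<^sub>R (\<integral>z. ?K (?u z y) \<partial>lborel) = 1"
      unfolding * c_def using r0 gauss_kernel_integral(2)[OF a, where 'a='a]
      by (subst lborel_integral_affine(2)[symmetric]) auto
  qed
  have val_u': "(\<integral>z. norm (?K (?u z y)) \<partial>lborel) = (\<integral>z. norm (?K (?u z 0)) \<partial>lborel)" for y
  proof -
    have *: "?u z y = - (sqrt t / sqrt s) *\<^sub>R y + (r / sqrt s) *\<^sub>R z" for z y :: 'a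
      by (simp add: scaleR_diff_right rs del: times_divide_eq_left times_divide_eq_right times_divide_times_eq)
    have "c *\<^sub>R (\<integral>z. norm (?K (?u z y)) \<partial>lborel) = (\<integral>z. norm (?K z) \<partial>lborel)" for y
      unfolding * c_def using r0 by (subst lborel_integral_affine(2)[symmetric]) auto
    from trans[OF this[of y] this[of 0, symmetric]] show ?thesis using c by simp
  qed
  let ?F = "\<lambda>y z. c *\<^sub>R (?K z * ?K (?w z y) * f (r *\<^sub>R y))"
  have F: "?F y z = c *\<^sub>R (?K (?u z y) * (?K y * f (r *\<^sub>R y)))" for y z
    unfolding gauss_kernel_mult_rotate[OF s t r_def] by (simp add: mult_ac)
  have intKf: "integrable lborel (\<lambda>y. ?K y * f (r *\<^sub>R y))"
    by (rule Bochner_Integration.integrable_bound[OF integrable_mult_right[OF gauss_kernel_integral(1)[OF a], of "of_real C"]])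
       (use f in \<open>auto intro!: AE_I2 mult_right_mono order_trans[OF _ abs_ge_self] simp: norm_mult mult.commute[of "norm (gauss_kernel _ _)"]\<close>)
  have int_F: "integrable (lborel \<Otimes>\<^sub>M lborel) (\<lambda>(y, z). ?F y z)"
  proof (rule lborel_pair.Fubini_integrable)
    show "(\<lambda>(y, z). ?F y z) \<in> borel_measurable (lborel \<Otimes>\<^sub>M lborel)"
      by measurable
    have "(\<lambda>y. \<integral>z. norm (?F y z) \<partial>lborel) = (\<lambda>y. c * ((\<integral>z. norm (?K (?u z 0)) \<partial>lborel) * norm (?K y * f (r *\<^sub>R y))))"
      unfolding F using c by (simp add: norm_mult val_u' mult.assoc fun_eq_iff)
    then show "integrable lborel (\<lambda>y. \<integral>z. norm (case (y, z) of (y, z) \<Rightarrow> ?F y z) \<partial>lborel)"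
      using intKf by (simp add: integrable_norm)
    show "AE y in lborel. integrable lborel (\<lambda>z. case (y, z) of (y, z) \<Rightarrow> ?F y z)"
      unfolding prod.case F using int_u by (intro AE_I2 integrable_scaleR_right integrable_mult_left) auto
  qed
  have "(\<integral>z. ?K z * (\<integral>w. ?K w * f (sqrt t *\<^sub>R z + sqrt s *\<^sub>R w) \<partial>lborel) \<partial>lborel) = (\<integral>z. \<integral>y. ?F y z \<partial>lborel \<partial>lborel)"
  proof (rule Bochner_Integration.integral_cong[OF refl])
    fix z
    have "(\<integral>w. ?K w * f (sqrt t *\<^sub>R z + sqrt s *\<^sub>R w) \<partial>lborel) = c *\<^sub>R (\<integral>y. ?K (?w z y) * f (sqrt t *\<^sub>R z + sqrt s *\<^sub>R ?w z y) \<partial>lborel)"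
      unfolding c_def using r0 by (subst lborel_integral_affine(2)[where t = "- (sqrt t / sqrt s) *\<^sub>R z" and c = "r / sqrt s"]) auto
    also have "\<dots> = c *\<^sub>R (\<integral>y. ?K (?w z y) * f (r *\<^sub>R y) \<partial>lborel)"
    proof -
      have "sqrt t *\<^sub>R z + sqrt s *\<^sub>R ?w z y = r *\<^sub>R y" for y
        using r0 by (simp only: scaleR_add_right scaleR_scaleR) simp
      then show ?thesis by simp
    qed
    finally show "?K z * (\<integral>w. ?K w * f (sqrt t *\<^sub>R z + sqrt s *\<^sub>R w) \<partial>lborel) = (\<integral>y. ?F y z \<partial>lborel)"
      by (simp add: mult.assoc)
  qed
  also have "\<dots> = (\<integral>y. \<integral>z. ?F y z \<partial>lborel \<partial>lborel)"
    by (rule lborel_pair.Fubini_integral[OF int_F])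
  also have "\<dots> = (\<integral>y. ?K y * f (r *\<^sub>R y) \<partial>lborel)"
  proof (rule Bochner_Integration.integral_cong[OF refl])
    fix y
    have "(\<integral>z. ?F y z \<partial>lborel) = (c *\<^sub>R (\<integral>z. ?K (?u z y) \<partial>lborel)) * (?K y * f (r *\<^sub>R y))"
      unfolding F by simp
    then show "(\<integral>z. ?F y z \<partial>lborel) = ?K y * f (r *\<^sub>R y)" unfolding val_u by simp
  qed
  finally show ?thesis by (simp only: r_def)
qed

section \<open>The function space\<close>

lemma borel_measurable_vecI:
  fixes f :: "'a \<Rightarrow> complex^'n"
  assumes "\<And>i. (\<lambda>x. f x $ i) \<in> borel_measurable M"
  shows "f \<in> borel_measurable M"
proof -
  have "(axis i :: complex \<Rightarrow> complex^'n) \<in> borel_measurable borel" for i :: 'n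
    proof (intro borel_measurable_continuous_onI linear_continuous_on linear_conv_bounded_linear[THEN iffD1] linearI)
  qed (auto simp: vec_eq_iff axis_def)
  note [measurable] = this assms
  have "f = (\<lambda>x. \<Sum>i\<in>UNIV. axis i (f x $ i))"
    by (simp add: fun_eq_iff vec_eq_iff axis_def if_distrib if_distribR cong: if_cong)
  then show ?thesis by (subst \<open>f = _\<close>) measurable
qed

lemma norm_vector_smult: "norm (c *s (v :: complex^'n)) = norm c * norm v"
proof -
  have "norm (c *s v) = L2_set (\<lambda>i. norm c * norm (v $ i)) UNIV"
    by (simp add: norm_vec_def norm_mult)
  then show ?thesis by (simp add: norm_vec_def L2_set_right_distrib)
qed

lemma bounded_bilinear_cscale:
  "bounded_bilinear (cscale :: complex \<Rightarrow> ('a::topological_space \<Rightarrow>\<^sub>C (complex^'n)) \<Rightarrow> _)"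
proof
  fix c c' :: complex and v w :: "'a \<Rightarrow>\<^sub>C (complex^'n)" and r :: real
  show "cscale (c + c') v = cscale c v + cscale c' v"
    by (rule bcontfun_eqI) (simp add: vector_sadd_rdistrib)
  show "cscale c (v + w) = cscale c v + cscale c w"
    by (rule bcontfun_eqI) (simp add: vector_add_ldistrib)
  show "cscale (r *\<^sub>R c) v = r *\<^sub>R cscale c v"
    by (rule bcontfun_eqI) (simp add: vec_eq_iff)
  show "cscale c (r *\<^sub>R v) = r *\<^sub>R cscale c v"
    by (rule bcontfun_eqI) (simp add: vec_eq_iff)
  have "norm (cscale c v) \<le> norm v * norm c * 1" for c and v :: "'a \<Rightarrow>\<^sub>C (complex^'n)"
    by (rule norm_bound) (simp add: norm_vector_smult norm_bounded mult_left_mono mult.commute[of _ "norm c"])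
  then show "\<exists>K. \<forall>c (v :: 'a \<Rightarrow>\<^sub>C (complex^'n)). norm (cscale c v) \<le> norm c * norm v * K"
    by (intro exI[of _ 1]) (simp add: mult.commute)
qed

lemma norm_cscale_le: "norm (cscale c v) \<le> norm c * norm v"
  by (rule norm_bound) (simp add: norm_vector_smult norm_bounded mult_left_mono)

lemma cscale_one [simp]: "cscale 1 v = v" by (rule bcontfun_eqI) simp

lemma cscale_cscale [simp]: "cscale c (cscale d v) = cscale (c * d) v"
  by (rule bcontfun_eqI) (simp add: vector_smult_assoc)

lemma C_rub_iff:
  "v \<in> C_rub S \<longleftrightarrow> uniformly_continuous_on UNIV (apply_bcontfun v) \<and>
    (\<forall>e>0. \<exists>d>0. \<forall>t x. \<bar>t\<bar> < d \<longrightarrow> norm (v (mat_exp (- t *\<^sub>R S) *v x) - v x) \<le> e)"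
proof -
  let ?n = "\<lambda>t x. norm (v (mat_exp (- t *\<^sub>R S) *v x) - v x)"
  have n0: "?n 0 x = 0" for x using mat_exp_zero[of S] by simp
  have bdd: "bdd_above (range (?n t))" for t
  proof (rule bdd_aboveI2)
    fix x show "?n t x \<le> norm v + norm v"
      by (rule order_trans[OF norm_triangle_ineq4 add_mono[OF norm_bounded norm_bounded]])
  qed
  have "((\<lambda>t. SUP x. ?n t x) \<longlongrightarrow> 0) (at 0) \<longleftrightarrow> (\<forall>e>0. \<exists>d>0. \<forall>t x. \<bar>t\<bar> < d \<longrightarrow> ?n t x \<le> e)"
  proof
    assume L: "((\<lambda>t. SUP x. ?n t x) \<longlongrightarrow> 0) (at 0)"
    show "\<forall>e>0. \<exists>d>0. \<forall>t x. \<bar>t\<bar> < d \<longrightarrow> ?n t x \<le> e"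
    proof (intro allI impI)
      fix e :: real assume "e > 0"
      with L obtain d where d: "d > 0" and D: "\<And>t. t \<noteq> 0 \<Longrightarrow> \<bar>t\<bar> < d \<Longrightarrow> \<bar>SUP x. ?n t x\<bar> < e"
        unfolding LIM_eq by auto
      have "?n t x \<le> e" if "\<bar>t\<bar> < d" for t x
      proof (cases "t = 0")
        case True
        then show ?thesis using n0[of x] \<open>e > 0\<close> by simp
      next
        case False
        have "?n t x \<le> (SUP x. ?n t x)" by (rule cSUP_upper[OF UNIV_I bdd])
        with D[OF False that] show ?thesis by linarith
      qed
      with d show "\<exists>d>0. \<forall>t x. \<bar>t\<bar> < d \<longrightarrow> ?n t x \<le> e" by blast
    qed
  next
    assume R: "\<forall>e>0. \<exists>d>0. \<forall>t x. \<bar>t\<bar> < d \<longrightarrow> ?n t x \<le> e"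
    show "((\<lambda>t. SUP x. ?n t x) \<longlongrightarrow> 0) (at 0)"
      unfolding LIM_eq
    proof (intro allI impI)
      fix e :: real assume e: "e > 0"
      then have "e / 2 > 0" by simp
      with R obtain d where d: "d > 0" and D: "\<And>t x. \<bar>t\<bar> < d \<Longrightarrow> ?n t x \<le> e / 2" by blast
      have "norm ((SUP x. ?n t x) - 0) < e" if "\<bar>t\<bar> < d" for t
      proof -
        have "(SUP x. ?n t x) \<le> e / 2" using D[OF that] by (intro cSUP_least) auto
        moreover have "0 \<le> (SUP x. ?n t x)" by (rule cSUP_upper2[OF bdd UNIV_I[of 0]]) simp
        ultimately show ?thesis using e by simp
      qed
      with d show "\<exists>d>0. \<forall>t. t \<noteq> 0 \<and> norm (t - 0) < d \<longrightarrow> norm ((SUP x. ?n t x) - 0) < e" by auto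
    qed
  qed
  then show ?thesis by (simp add: C_rub_def)
qed

text \<open>Closedness and linearity both follow from this approximation criterion.\<close>

lemma C_rub_approx:
  fixes v :: "(real^'d) \<Rightarrow>\<^sub>C (complex^'n)"
  assumes "\<And>e. e > 0 \<Longrightarrow> \<exists>w\<in>(C_rub S :: ((real^'d) \<Rightarrow>\<^sub>C (complex^'n)) set). \<exists>w'\<in>(C_rub S :: ((real^'d) \<Rightarrow>\<^sub>C (complex^'n)) set). \<exists>c\<ge>0.
      \<forall>x y. norm (v x - v y) \<le> norm (w x - w y) + c * norm (w' x - w' y) + e"
  shows "v \<in> C_rub S"
  unfolding C_rub_iff
proof (intro conjI allI impI)
  have split: "\<exists>w\<in>(C_rub S :: ((real^'d) \<Rightarrow>\<^sub>C (complex^'n)) set). \<exists>w'\<in>(C_rub S :: ((real^'d) \<Rightarrow>\<^sub>C (complex^'n)) set). \<exists>c>0. \<forall>x y. norm (w x - w y) \<le> e / 4 \<longrightarrow>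
      norm (w' x - w' y) \<le> c \<longrightarrow> norm (v x - v y) \<le> 3 / 4 * e" if e: "e > 0" for e
  proof -
    have "e / 4 > 0" using e by simp
    from assms[OF this] obtain w w' :: "(real^'d) \<Rightarrow>\<^sub>C (complex^'n)" and c where w: "w \<in> C_rub S" "w' \<in> C_rub S" "c \<ge> 0"
      and *: "\<And>x y. norm (v x - v y) \<le> norm (w x - w y) + c * norm (w' x - w' y) + e / 4" by blast
    have "norm (v x - v y) \<le> 3 / 4 * e" if "norm (w x - w y) \<le> e / 4" "norm (w' x - w' y) \<le> e / 4 / (c + 1)" for x y
    proof -
      have "c * norm (w' x - w' y) \<le> (c + 1) * (e / 4 / (c + 1))"
        using w that by (intro mult_mono) auto
      also have "\<dots> = e / 4"
        using w by (subst times_divide_eq_right, subst nonzero_mult_div_cancel_left) auto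
      finally have "c * norm (w' x - w' y) \<le> e / 4" .
      with *[of x y] that show ?thesis by simp
    qed
    moreover have "e / 4 / (c + 1) > 0" using w e by simp
    ultimately show ?thesis using w by blast
  qed
  show "uniformly_continuous_on UNIV (apply_bcontfun v)"
    unfolding uniformly_continuous_on_def
  proof (intro allI impI)
    fix e :: real assume e: "e > 0"
    from split[OF this] obtain w w' :: "(real^'d) \<Rightarrow>\<^sub>C (complex^'n)" and c where w: "w \<in> C_rub S" "w' \<in> C_rub S" "c > 0"
      and *: "\<And>x y. norm (w x - w y) \<le> e / 4 \<Longrightarrow> norm (w' x - w' y) \<le> c \<Longrightarrow> norm (v x - v y) \<le> 3 / 4 * e" by blast
    from w(1) e obtain d where d: "d > 0" "\<And>x x'. dist x' x < d \<Longrightarrow> dist (w x') (w x) < e / 4"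
      unfolding C_rub_iff uniformly_continuous_on_def by (metis UNIV_I divide_pos_pos zero_less_numeral)
    from w obtain d' where d': "d' > 0" "\<And>x x'. dist x' x < d' \<Longrightarrow> dist (w' x') (w' x) < c"
      unfolding C_rub_iff uniformly_continuous_on_def by (metis UNIV_I)
    show "\<exists>d>0. \<forall>x\<in>UNIV. \<forall>x'\<in>UNIV. dist x' x < d \<longrightarrow> dist (v x') (v x) < e"
    proof (intro exI[of _ "min d d'"] conjI ballI impI)
      fix x x' :: "real^'d" assume "dist x' x < min d d'"
      then have "norm (v x' - v x) \<le> 3 / 4 * e"
        using d(2)[of x' x] d'(2)[of x' x] by (intro *) (auto simp: dist_norm)
      then show "dist (v x') (v x) < e" using e by (simp add: dist_norm)
    qed (use d d' in auto)
  qed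
  fix e :: real assume e: "e > 0"
  from split[OF this] obtain w w' :: "(real^'d) \<Rightarrow>\<^sub>C (complex^'n)" and c where w: "w \<in> C_rub S" "w' \<in> C_rub S" "c > 0"
    and *: "\<And>x y. norm (w x - w y) \<le> e / 4 \<Longrightarrow> norm (w' x - w' y) \<le> c \<Longrightarrow> norm (v x - v y) \<le> 3 / 4 * e" by blast
  have "e / 4 > 0" using e by simp
  with w(1) obtain d where d: "d > 0" "\<And>t x. \<bar>t\<bar> < d \<Longrightarrow> norm (w (mat_exp (- t *\<^sub>R S) *v x) - w x) \<le> e / 4"
    unfolding C_rub_iff by meson
  from w obtain d' where d': "d' > 0" "\<And>t x. \<bar>t\<bar> < d' \<Longrightarrow> norm (w' (mat_exp (- t *\<^sub>R S) *v x) - w' x) \<le> c"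
    unfolding C_rub_iff by meson
  show "\<exists>d>0. \<forall>t x. \<bar>t\<bar> < d \<longrightarrow> norm (v (mat_exp (- t *\<^sub>R S) *v x) - v x) \<le> e"
  proof (intro exI[of _ "min d d'"] conjI allI impI)
    fix t and x :: "real^'d" assume "\<bar>t\<bar> < min d d'"
    then have "norm (v (mat_exp (- t *\<^sub>R S) *v x) - v x) \<le> 3 / 4 * e"
      by (intro * d d') auto
    then show "norm (v (mat_exp (- t *\<^sub>R S) *v x) - v x) \<le> e" using e by simp
  qed (use d d' in auto)
qed

lemma C_rub_cscale: "(v :: (real^'d) \<Rightarrow>\<^sub>C (complex^'n)) \<in> C_rub S \<Longrightarrow> cscale c v \<in> C_rub S"
proof (rule C_rub_approx)
  assume v: "v \<in> C_rub S"
  fix e :: real assume "e > 0"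
  then have "\<forall>x y. norm (cscale c v x - cscale c v y) \<le> norm (v x - v y) + norm c * norm (v x - v y) + e"
    by (simp flip: vector_ssub_ldistrib add: norm_vector_smult add_increasing2)
  with v show "\<exists>w\<in>(C_rub S :: ((real^'d) \<Rightarrow>\<^sub>C (complex^'n)) set). \<exists>w'\<in>(C_rub S :: ((real^'d) \<Rightarrow>\<^sub>C (complex^'n)) set). \<exists>c'\<ge>0.
      \<forall>x y. norm (cscale c v x - cscale c v y) \<le> norm (w x - w y) + c' * norm (w' x - w' y) + e"
    by (intro bexI[of _ v] exI[of _ "norm c"]) auto
qed

lemma C_rub_add: "(v :: (real^'d) \<Rightarrow>\<^sub>C (complex^'n)) \<in> C_rub S \<Longrightarrow> w \<in> C_rub S \<Longrightarrow> v + w \<in> C_rub S"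
proof (rule C_rub_approx)
  assume v: "v \<in> C_rub S" "w \<in> C_rub S"
  fix e :: real assume e: "e > 0"
  have "norm ((v + w) x - (v + w) y) \<le> norm (v x - v y) + 1 * norm (w x - w y) + e" for x y
    using norm_triangle_ineq[of "v x - v y" "w x - w y"] e by (simp add: algebra_simps)
  with v show "\<exists>u\<in>(C_rub S :: ((real^'d) \<Rightarrow>\<^sub>C (complex^'n)) set). \<exists>w'\<in>(C_rub S :: ((real^'d) \<Rightarrow>\<^sub>C (complex^'n)) set). \<exists>c'\<ge>0.
      \<forall>x y. norm ((v + w) x - (v + w) y) \<le> norm (u x - u y) + c' * norm (w' x - w' y) + e"
    by (intro bexI[of _ v] bexI[of _ w] exI[of _ 1]) auto
qed

lemma C_rub_zero: "0 \<in> C_rub S"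
  by (auto simp: C_rub_iff uniformly_continuous_on_def intro: exI[of _ 1])

lemma C_rub_subspace: "subspace (C_rub S :: ((real^'d) \<Rightarrow>\<^sub>C (complex^'n)) set)"
proof (rule subspaceI)
  fix c :: real and v :: "(real^'d) \<Rightarrow>\<^sub>C (complex^'n)" assume v: "v \<in> C_rub S"
  have "c *\<^sub>R v = cscale (of_real c) v"
    by (rule bcontfun_eqI) (simp add: vec_eq_iff scaleR_conv_of_real[where 'a = complex])
  then show "c *\<^sub>R v \<in> C_rub S" by (simp add: C_rub_cscale[OF v])
qed (use C_rub_add C_rub_zero in auto)

lemma C_rub_closed: "closed (C_rub S :: ((real^'d) \<Rightarrow>\<^sub>C (complex^'n)) set)"
proof -
  have "v \<in> C_rub S" if "v \<in> closure (C_rub S)" for v :: "(real^'d) \<Rightarrow>\<^sub>C (complex^'n)"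
  proof (rule C_rub_approx)
    fix e :: real assume "e > 0"
    then have "e / 2 > 0" by simp
    with that obtain w where w: "w \<in> C_rub S" and d: "dist w v < e / 2"
      unfolding closure_approachable by blast
    have "norm (v x - v y) \<le> norm (w x - w y) + 0 * norm (w x - w y) + e" for x y
    proof -
      have "norm (v x - v y) \<le> dist (v x) (w x) + norm (w x - w y) + dist (w y) (v y)"
        unfolding dist_norm by norm
      then show ?thesis using dist_bounded[of v x w] dist_bounded[of w y v] d by (simp add: dist_commute)
    qed
    with w show "\<exists>w\<in>(C_rub S :: ((real^'d) \<Rightarrow>\<^sub>C (complex^'n)) set). \<exists>w'\<in>(C_rub S :: ((real^'d) \<Rightarrow>\<^sub>C (complex^'n)) set). \<exists>c\<ge>0.
      \<forall>x y. norm (v x - v y) \<le> norm (w x - w y) + c * norm (w' x - w' y) + e"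
      by (intro bexI[of _ w] exI[of _ 0]) auto
  qed
  then show ?thesis using closure_subset_eq by blast
qed

section \<open>The semigroup and its resolvent\<close>

locale ou_kernel =
  fixes Y :: "complex^'n^'n" and \<alpha> \<beta> :: "'n \<Rightarrow> complex" and S :: "real^'d^'d"
  assumes Y: "invertible Y" and \<alpha>: "Re (\<alpha> k) > 0" and S: "transpose S = - S"
begin

abbreviation "A \<equiv> conj_diag Y \<alpha>"
abbreviation "B \<equiv> conj_diag Y \<beta>"
abbreviation "E t \<equiv> mat_exp (t *\<^sub>R S)"
abbreviation "coord u k \<equiv> (matrix_inv Y *v u) $ k"
definition Mb :: real where "Mb = cond_number Y * a_one A powr (real CARD('d) / 2)"

definition \<Gamma> :: "real \<Rightarrow> real^'d \<Rightarrow> complex^'n^'n" where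
  "\<Gamma> t z = conj_diag Y (\<lambda>k. exp (- (\<beta> k * of_real t)) * gauss_kernel (\<alpha> k) z)"

definition \<gamma> :: "real^'d \<Rightarrow> real" where
  "\<gamma> z = (4 * pi * a_min A) powr (- real CARD('d) / 2) * exp (- (min_Re_spec A / (4 * (a_max A)\<^sup>2)) * (norm z)\<^sup>2)"

text \<open>After the substitution \<open>\<xi> = e\<^sup>t\<^sup>S x - \<surd>t z\<close> the kernel depends on \<open>t\<close> only through a factor
  \<open>e\<^sup>-\<^sup>t\<^sup>B\<close>, and the formula makes sense for \<open>t = 0\<close> as well.\<close>

definition ou :: "real \<Rightarrow> ((real^'d) \<Rightarrow>\<^sub>C (complex^'n)) \<Rightarrow> real^'d \<Rightarrow> complex^'n" where
  "ou t v x = (\<integral>z. \<Gamma> t z *v v (E t *v x - sqrt t *\<^sub>R z) \<partial>lborel)"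

lemma spectral_bounds:
  "min_Re_spec A \<le> Re (\<alpha> k)" "a_min A \<le> norm (\<alpha> k)" "norm (\<alpha> k) \<le> a_max A"
  "min_Re_spec B \<le> Re (\<beta> k)" "min_Re_spec A > 0" "a_min A > 0" "a_max A > 0"
proof -
  show "min_Re_spec A \<le> Re (\<alpha> k)" "a_min A \<le> norm (\<alpha> k)" and le: "norm (\<alpha> k) \<le> a_max A" for k
    by (auto simp: min_Re_spec_def a_min_def a_max_def conj_diag_spectrum[OF Y] image_image)
  show "min_Re_spec B \<le> Re (\<beta> k)"
    by (auto simp: min_Re_spec_def conj_diag_spectrum[OF Y] image_image)
  have nz: "\<alpha> k \<noteq> 0" for k using \<alpha>[of k] by auto
  have "min_Re_spec A \<in> range (\<lambda>k. Re (\<alpha> k))" "a_min A \<in> range (\<lambda>k. norm (\<alpha> k))"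
    unfolding min_Re_spec_def a_min_def conj_diag_spectrum[OF Y] image_image by (intro Min_in; simp)+
  then show "min_Re_spec A > 0" "a_min A > 0" using \<alpha> nz by auto
  show "a_max A > 0" using le[of k] nz[of k] by (meson less_le_trans zero_less_norm_iff)
qed

lemma E_orthogonal: "orthogonal_transformation ((*v) (E t))"
  by (rule mat_exp_orthogonal[OF S])

lemma norm_E [simp]: "norm (E t *v x) = norm x"
  using E_orthogonal[of t] by (simp add: orthogonal_transformation)

lemma \<gamma>_integral: "integrable lborel \<gamma>" "(\<integral>z. \<gamma> z \<partial>lborel) = a_one A powr (real CARD('d) / 2)"
    "integrable lborel (\<lambda>z. \<gamma> z * (norm z)\<^sup>2)" and \<gamma>_nonneg: "\<gamma> z \<ge> 0"
proof -
  let ?c = "min_Re_spec A / (4 * (a_max A)\<^sup>2)"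
  have c: "?c > 0" using spectral_bounds by simp
  show "integrable lborel \<gamma>"
    unfolding \<gamma>_def[abs_def] by (intro integrable_mult_right gaussian_integrable[OF c])
  show "integrable lborel (\<lambda>z. \<gamma> z * (norm z)\<^sup>2)"
    unfolding \<gamma>_def[abs_def] mult.assoc by (intro integrable_mult_right gaussian_second_moment_integrable[OF c])
  have "(\<integral>z. \<gamma> z \<partial>lborel) = (4 * pi * a_min A) powr (- real CARD('d) / 2) * (pi / ?c) powr (real CARD('d) / 2)"
    unfolding \<gamma>_def[abs_def] using gaussian_real[OF c, where 'a = "real^'d"]
    by (simp add: has_bochner_integral_iff)
  also have "(4 * pi * a_min A) powr (- real CARD('d) / 2) = (1 / (4 * pi * a_min A)) powr (real CARD('d) / 2)"
    using spectral_bounds by (simp add: powr_minus_divide powr_divide)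
  also have "\<dots> * (pi / ?c) powr (real CARD('d) / 2) = (1 / (4 * pi * a_min A) * (pi / ?c)) powr (real CARD('d) / 2)"
    by (rule powr_mult[symmetric])
  also have "1 / (4 * pi * a_min A) * (pi / ?c) = a_one A"
    using spectral_bounds by (simp add: a_one_def field_simps)
  finally show "(\<integral>z. \<gamma> z \<partial>lborel) = a_one A powr (real CARD('d) / 2)" .
  show "\<gamma> z \<ge> 0" by (simp add: \<gamma>_def)
qed

lemma \<Gamma>_bound:
  assumes t: "t \<ge> 0"
  shows "norm (\<Gamma> t z *v u) \<le> cond_number Y * exp (- min_Re_spec B * t) * (\<gamma> z * norm u)"
proof -
  have "norm (exp (- (\<beta> k * of_real t)) * gauss_kernel (\<alpha> k) z) \<le> exp (- min_Re_spec B * t) * \<gamma> z" for k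
    unfolding norm_mult
  proof (rule mult_mono)
    show "norm (exp (- (\<beta> k * of_real t))) \<le> exp (- min_Re_spec B * t)"
      using t spectral_bounds(4)[of k] by (simp add: mult_right_mono)
    show "norm (gauss_kernel (\<alpha> k) z) \<le> \<gamma> z"
      using gauss_kernel_norm_le[of "min_Re_spec A" "\<alpha> k" "a_min A" "a_max A" z] spectral_bounds
      by (simp add: \<gamma>_def)
  qed auto
  from conj_diag_norm[OF Y this] show ?thesis unfolding \<Gamma>_def by (simp add: mult_ac)
qed

lemma coord_\<Gamma>: "coord (\<Gamma> t z *v u) k = exp (- (\<beta> k * of_real t)) * (gauss_kernel (\<alpha> k) z * coord u k)"
  by (simp add: \<Gamma>_def conj_diag_vector matrix_vector_mul_assoc matrix_inv_both[OF Y] mult.assoc)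

lemma coord_bounded_linear: "bounded_linear (\<lambda>u. coord u k)"
  by (rule bounded_linear_compose[OF bounded_linear_vec_nth matrix_vector_mul_bounded_linear])

lemma coord_eqI: assumes "\<And>k. coord u k = coord w k" shows "u = w"
proof -
  have "matrix_inv Y *v u = matrix_inv Y *v w" using assms by (simp add: vec_eq_iff)
  then have "Y *v (matrix_inv Y *v u) = Y *v (matrix_inv Y *v w)" by simp
  then show ?thesis by (simp add: matrix_vector_mul_assoc matrix_inv_both[OF Y])
qed

lemma coord_measurable [measurable (raw)]:
  "\<phi> \<in> borel_measurable M \<Longrightarrow> (\<lambda>x. coord (\<phi> x) k) \<in> borel_measurable M"
  by (rule measurable_compose[OF _ borel_measurable_continuous_onI[OF linear_continuous_on[OF coord_bounded_linear]]])

lemma \<Gamma>_measurable: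
  assumes [measurable]: "\<phi> \<in> borel_measurable borel"
  shows "(\<lambda>z. \<Gamma> t z *v \<phi> z) \<in> borel_measurable borel"
proof -
  have 1: "(\<lambda>z. \<chi> k. coord (\<Gamma> t z *v \<phi> z) k) \<in> borel_measurable borel"
    by (rule borel_measurable_vecI) (simp only: vec_lambda_beta coord_\<Gamma>, measurable)
  have "(\<lambda>u :: complex^'n. Y *v u) \<in> borel_measurable borel"
    by (intro borel_measurable_continuous_onI linear_continuous_on matrix_vector_mul_bounded_linear)
  from measurable_compose[OF 1 this] show ?thesis
    by (simp add: matrix_vector_mul_assoc matrix_mul_assoc matrix_inv_both[OF Y] vec_lambda_eta)
qed

lemma \<Gamma>_integral:
  assumes t: "t \<ge> 0" and [measurable]: "\<phi> \<in> borel_measurable borel"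
    and h: "integrable lborel (\<lambda>z. \<gamma> z * h z)" and \<phi>: "\<And>z. norm (\<phi> z) \<le> h z"
  shows "integrable lborel (\<lambda>z. \<Gamma> t z *v \<phi> z)"
    and "norm (\<integral>z. \<Gamma> t z *v \<phi> z \<partial>lborel) \<le> cond_number Y * exp (- min_Re_spec B * t) * (\<integral>z. \<gamma> z * h z \<partial>lborel)"
    and "coord (\<integral>z. \<Gamma> t z *v \<phi> z \<partial>lborel) k
      = exp (- (\<beta> k * of_real t)) * (\<integral>z. gauss_kernel (\<alpha> k) z * coord (\<phi> z) k \<partial>lborel)"
proof -
  let ?c = "cond_number Y * exp (- min_Re_spec B * t)"
  have le: "norm (\<Gamma> t z *v \<phi> z) \<le> ?c * (\<gamma> z * h z)" for z
    using \<phi>[of z] \<gamma>_nonneg[of z] cond_number_nonneg[OF Y]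
    by (intro order_trans[OF \<Gamma>_bound[OF t]] mult_left_mono) auto
  have int: "integrable lborel (\<lambda>z. ?c * (\<gamma> z * h z))" by (intro integrable_mult_right h)
  show i: "integrable lborel (\<lambda>z. \<Gamma> t z *v \<phi> z)"
    by (rule Bochner_Integration.integrable_bound[OF int])
      (use order_trans[OF le abs_ge_self] \<Gamma>_measurable[of \<phi> t] in auto)
  have "norm (\<integral>z. \<Gamma> t z *v \<phi> z \<partial>lborel) \<le> (\<integral>z. norm (\<Gamma> t z *v \<phi> z) \<partial>lborel)"
    by (rule integral_norm_bound)
  also have "\<dots> \<le> (\<integral>z. ?c * (\<gamma> z * h z) \<partial>lborel)"
    by (rule integral_mono[OF integrable_norm[OF i] int le])
  finally show "norm (\<integral>z. \<Gamma> t z *v \<phi> z \<partial>lborel) \<le> ?c * (\<integral>z. \<gamma> z * h z \<partial>lborel)" by simp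
  show "coord (\<integral>z. \<Gamma> t z *v \<phi> z \<partial>lborel) k
      = exp (- (\<beta> k * of_real t)) * (\<integral>z. gauss_kernel (\<alpha> k) z * coord (\<phi> z) k \<partial>lborel)"
    using integral_bounded_linear[OF coord_bounded_linear i, of k]
    by (simp add: coord_\<Gamma>)
qed

lemma \<Gamma>_integral_const:
  assumes t: "t \<ge> 0" and \<phi>: "\<phi> \<in> borel_measurable borel" and c: "\<And>z. norm (\<phi> z) \<le> c"
  shows "integrable lborel (\<lambda>z. \<Gamma> t z *v \<phi> z)"
    and "norm (\<integral>z. \<Gamma> t z *v \<phi> z \<partial>lborel) \<le> Mb * exp (- min_Re_spec B * t) * c"
    and "coord (\<integral>z. \<Gamma> t z *v \<phi> z \<partial>lborel) k
      = exp (- (\<beta> k * of_real t)) * (\<integral>z. gauss_kernel (\<alpha> k) z * coord (\<phi> z) k \<partial>lborel)"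
  using \<Gamma>_integral[OF t \<phi> integrable_mult_left[OF \<gamma>_integral(1)] c]
  by (simp_all add: \<gamma>_integral Mb_def mult_ac)

lemma bcontfun_measurable [measurable (raw)]:
  "\<phi> \<in> borel_measurable M \<Longrightarrow> (\<lambda>x. apply_bcontfun (v :: (real^'d) \<Rightarrow>\<^sub>C (complex^'n)) (\<phi> x)) \<in> borel_measurable M"
  by (rule measurable_compose[OF _ borel_measurable_continuous_onI]) auto

lemma ou_integrand_measurable [measurable]:
  "(\<lambda>z. apply_bcontfun v (x - c *\<^sub>R z)) \<in> borel_measurable borel" for v :: "(real^'d) \<Rightarrow>\<^sub>C (complex^'n)"
  by measurable

lemma ou_norm: "t \<ge> 0 \<Longrightarrow> norm (ou t v x) \<le> Mb * exp (- min_Re_spec B * t) * norm v"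
  unfolding ou_def by (rule \<Gamma>_integral_const(2)[OF _ ou_integrand_measurable norm_bounded])

lemma ou_coord:
  fixes v :: "(real^'d) \<Rightarrow>\<^sub>C (complex^'n)"
  assumes "t \<ge> 0"
  shows "coord (ou t v x) k
    = exp (- (\<beta> k * of_real t)) * (\<integral>z. gauss_kernel (\<alpha> k) z * coord (v (E t *v x - sqrt t *\<^sub>R z)) k \<partial>lborel)"
  unfolding ou_def by (rule \<Gamma>_integral_const(3)[OF assms ou_integrand_measurable norm_bounded])

lemma \<Gamma>_integral_diff:
  assumes t: "t \<ge> 0" and "\<phi> \<in> borel_measurable borel" "\<psi> \<in> borel_measurable borel"
    and "\<And>z. norm (\<phi> z) \<le> c" "\<And>z. norm (\<psi> z) \<le> c'"
  shows "(\<integral>z. \<Gamma> t z *v (\<phi> z - \<psi> z) \<partial>lborel) = (\<integral>z. \<Gamma> t z *v \<phi> z \<partial>lborel) - (\<integral>z. \<Gamma> t z *v \<psi> z \<partial>lborel)"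
  unfolding matrix_vector_mult_diff_distrib
  by (intro Bochner_Integration.integral_diff \<Gamma>_integral_const(1)[OF t _ assms(4)]
      \<Gamma>_integral_const(1)[OF t _ assms(5)] assms(2,3))

lemma ou_diff:
  assumes "t \<ge> 0"
  shows "ou t v x - ou t w y = (\<integral>z. \<Gamma> t z *v (v (E t *v x - sqrt t *\<^sub>R z) - w (E t *v y - sqrt t *\<^sub>R z)) \<partial>lborel)"
  unfolding ou_def
  by (rule \<Gamma>_integral_diff[OF assms ou_integrand_measurable ou_integrand_measurable norm_bounded norm_bounded, symmetric])

lemma ou_diff_norm:
  fixes v w :: "(real^'d) \<Rightarrow>\<^sub>C (complex^'n)"
  assumes t: "t \<ge> 0" and le: "\<And>z. norm (v (E t *v x - sqrt t *\<^sub>R z) - w (E t *v y - sqrt t *\<^sub>R z)) \<le> c"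
  shows "norm (ou t v x - ou t w y) \<le> Mb * exp (- min_Re_spec B * t) * c"
  unfolding ou_diff[OF t] by (rule \<Gamma>_integral_const(2)[OF t _ le]) measurable

lemma ou_continuous: assumes t: "t \<ge> 0" shows "continuous_on UNIV (ou t v)"
  unfolding continuous_on_sequentially
proof (intro ballI allI impI)
  fix X and x :: "real^'d" assume X: "(\<forall>n. X n \<in> UNIV) \<and> X \<longlonglongrightarrow> x"
  let ?c = "cond_number Y * exp (- min_Re_spec B * t)"
  show "(ou t v \<circ> X) \<longlonglongrightarrow> ou t v x"
    unfolding o_def ou_def
  proof (rule integral_dominated_convergence)
    show "integrable lborel (\<lambda>z. ?c * (\<gamma> z * norm v))"
      by (intro integrable_mult_right integrable_mult_left \<gamma>_integral)
    show "AE z in lborel. norm (\<Gamma> t z *v v (E t *v X n - sqrt t *\<^sub>R z)) \<le> ?c * (\<gamma> z * norm v)" for n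
      using \<gamma>_nonneg cond_number_nonneg[OF Y]
      by (intro AE_I2 order_trans[OF \<Gamma>_bound[OF t]] mult_left_mono norm_bounded) auto
    have "(\<lambda>n. \<Gamma> t z *v v (E t *v X n - sqrt t *\<^sub>R z)) \<longlonglongrightarrow> \<Gamma> t z *v v (E t *v x - sqrt t *\<^sub>R z)" for z
    proof -
      have "(\<lambda>n. E t *v X n - sqrt t *\<^sub>R z) \<longlonglongrightarrow> E t *v x - sqrt t *\<^sub>R z"
        using X by (intro tendsto_diff tendsto_const bounded_linear.tendsto[OF matrix_vector_mul_bounded_linear]) auto
      then have "(\<lambda>n. v (E t *v X n - sqrt t *\<^sub>R z)) \<longlonglongrightarrow> v (E t *v x - sqrt t *\<^sub>R z)"
        by (rule continuous_on_tendsto_compose[OF continuous_on_apply_bcontfun[of UNIV v]]) auto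
      then show ?thesis
        by (rule bounded_linear.tendsto[OF matrix_vector_mul_bounded_linear])
    qed
    then show "AE z in lborel. (\<lambda>n. \<Gamma> t z *v v (E t *v X n - sqrt t *\<^sub>R z)) \<longlonglongrightarrow> \<Gamma> t z *v v (E t *v x - sqrt t *\<^sub>R z)"
      by simp
  qed (simp_all add: \<Gamma>_measurable)
qed

lemma ou_zero: "ou 0 v x = v x"
proof (rule coord_eqI)
  fix k
  show "coord (ou 0 v x) k = coord (v x) k"
    by (simp add: ou_coord mat_exp_zero[simplified] gauss_kernel_integral[OF \<alpha>])
qed

lemma heat_kernel_\<Gamma>:
  assumes t: "t > 0"
  shows "(sqrt t ^ CARD('d)) *\<^sub>R heat_kernel A B S x (E t *v x - sqrt t *\<^sub>R z) t = \<Gamma> t z"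
proof -
  have nz: "\<alpha> k \<noteq> 0" for k using \<alpha>[of k] by auto
  have 1: "mat_powr ((4 * pi * t) *\<^sub>R A) (- of_nat CARD('d) / 2)
      = conj_diag Y (\<lambda>k. of_real (t powr (- real CARD('d) / 2)) * exp (- of_nat CARD('d) / 2 * Ln (of_real (4 * pi) * \<alpha> k)))"
  proof -
    have "Ln (of_real (4 * pi * t) * \<alpha> k) = of_real (ln t) + Ln (of_real (4 * pi) * \<alpha> k)" for k
      using Ln_times_of_real[OF t, of "of_real (4 * pi) * \<alpha> k"] nz[of k] t by (simp add: mult_ac Ln_of_real)
    moreover have "of_real (t powr (- real CARD('d) / 2)) = exp (- of_nat CARD('d) / 2 * complex_of_real (ln t))"
      using t by (simp add: powr_def flip: exp_of_real)
    ultimately show ?thesis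
      unfolding conj_diag_linear(3)[symmetric] conj_diag_powr[OF Y] by (simp add: exp_add[symmetric] algebra_simps)
  qed
  have 2: "matrix_inv ((4 * t) *\<^sub>R A) = conj_diag Y (\<lambda>k. 1 / (of_real (4 * t) * \<alpha> k))"
    unfolding conj_diag_linear(3)[symmetric] using t nz by (intro conj_diag_inv[OF Y]) auto
  have "(norm (E t *v x - (E t *v x - sqrt t *\<^sub>R z)))\<^sup>2 = t * (norm z)\<^sup>2"
    using t by (simp add: power_mult_distrib)
  then have 3: "mat_exp (- (t *\<^sub>R B) - (norm (E t *v x - (E t *v x - sqrt t *\<^sub>R z)))\<^sup>2 *\<^sub>R matrix_inv ((4 * t) *\<^sub>R A))
      = conj_diag Y (\<lambda>k. exp (- (of_real t * \<beta> k) - of_real (t * (norm z)\<^sup>2) * (1 / (of_real (4 * t) * \<alpha> k))))"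
    unfolding 2 by (simp only: conj_diag_linear[symmetric] conj_diag_exp[OF Y])
  have "sqrt t ^ CARD('d) * t powr (- real CARD('d) / 2) = 1"
    using t by (simp add: powr_half_sqrt[symmetric] powr_realpow[symmetric] powr_powr flip: powr_add)
  then have 4: "complex_of_real (sqrt t) ^ CARD('d) * of_real (t powr (- real CARD('d) / 2)) = 1"
    by (metis of_real_1 of_real_mult of_real_power)
  show ?thesis
    unfolding heat_kernel_def 1 3 unfolding conj_diag_mult[OF Y] \<Gamma>_def unfolding conj_diag_linear(3)[symmetric]
  proof (rule arg_cong[where f = "conj_diag Y"], rule ext)
    fix k
    have 5: "- (of_real t * \<beta> k) - of_real (t * (norm z)\<^sup>2) * (1 / (of_real (4 * t) * \<alpha> k))
      = - (\<beta> k * of_real t) + - of_real ((norm z)\<^sup>2) / (4 * \<alpha> k)"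
      using t by (simp add: mult.commute)
    show "of_real (sqrt t ^ CARD('d)) * (of_real (t powr (- real CARD('d) / 2)) * exp (- of_nat CARD('d) / 2 * Ln (of_real (4 * pi) * \<alpha> k)) *
        exp (- (of_real t * \<beta> k) - of_real (t * (norm z)\<^sup>2) * (1 / (of_real (4 * t) * \<alpha> k))))
      = exp (- (\<beta> k * of_real t)) * gauss_kernel (\<alpha> k) z"
      unfolding 5 exp_add gauss_kernel_def using 4 by simp
  qed
qed

lemma scaleR_matrix_vector_mult: "(c *\<^sub>R M) *v (u :: complex^'n) = c *\<^sub>R (M *v u)"
  by (simp add: vec_eq_iff matrix_vector_mult_def scaleR_sum_right)

lemma ou_heat_kernel:
  fixes v :: "(real^'d) \<Rightarrow>\<^sub>C (complex^'n)"
  assumes t: "t > 0"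
  shows "(\<integral>\<xi>. heat_kernel A B S x \<xi> t *v v \<xi> \<partial>lborel) = ou t v x"
proof -
  have "(\<integral>\<xi>. heat_kernel A B S x \<xi> t *v v \<xi> \<partial>lborel)
    = \<bar>- sqrt t\<bar> ^ DIM(real^'d) *\<^sub>R (\<integral>z. heat_kernel A B S x (E t *v x + (- sqrt t) *\<^sub>R z) t *v v (E t *v x + (- sqrt t) *\<^sub>R z) \<partial>lborel)"
    using t by (intro lborel_integral_affine(2)) auto
  also have "\<dots> = (\<integral>z. (sqrt t ^ CARD('d)) *\<^sub>R (heat_kernel A B S x (E t *v x - sqrt t *\<^sub>R z) t *v v (E t *v x - sqrt t *\<^sub>R z)) \<partial>lborel)"
    using t by (subst integral_scaleR_right) simp
  also have "\<dots> = ou t v x"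
    unfolding ou_def by (intro Bochner_Integration.integral_cong refl) (simp only: scaleR_matrix_vector_mult[symmetric] heat_kernel_\<Gamma>[OF t])
  finally show ?thesis .
qed

lemma ou_apply [simp]: assumes t: "t \<ge> 0"
  shows "apply_bcontfun (OU_semigroup A B S t v) x = ou t v x"
proof (cases "t = 0")
  case True
  then show ?thesis by (simp add: OU_semigroup_def ou_zero)
next
  case False
  with t have "t > 0" by simp
  moreover have "ou t v \<in> bcontfun"
    by (rule bcontfun_normI[OF ou_continuous[OF t]]) (unfold ou_def, rule \<Gamma>_integral_const(2)[OF t ou_integrand_measurable norm_bounded])
  ultimately show ?thesis
    by (simp add: OU_semigroup_def ou_heat_kernel Bcontfun_inverse)
qed

lemma OU_norm: "t \<ge> 0 \<Longrightarrow> norm (OU_semigroup A B S t v) \<le> Mb * exp (- min_Re_spec B * t) * norm v"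
  by (rule norm_bound) (simp only: ou_apply ou_norm)

lemma OU_linear: assumes t: "t \<ge> 0" shows "bounded_linear (OU_semigroup A B S t)"
proof
  fix v w :: "(real^'d) \<Rightarrow>\<^sub>C (complex^'n)" and r :: real
  show "OU_semigroup A B S t (v + w) = OU_semigroup A B S t v + OU_semigroup A B S t w"
  proof (rule bcontfun_eqI)
    fix x
    have "ou t (v + w) x = ou t v x + ou t w x"
      unfolding ou_def plus_bcontfun.rep_eq matrix_vector_right_distrib
      by (intro Bochner_Integration.integral_add \<Gamma>_integral_const(1)[OF t ou_integrand_measurable norm_bounded])
    then show "OU_semigroup A B S t (v + w) x = (OU_semigroup A B S t v + OU_semigroup A B S t w) x" using t by simp
  qed
  show "OU_semigroup A B S t (r *\<^sub>R v) = r *\<^sub>R OU_semigroup A B S t v"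
    using t by (intro bcontfun_eqI) (simp add: ou_def linear_scale[OF matrix_vector_mul_linear])
  show "\<exists>K. \<forall>v. norm (OU_semigroup A B S t v) \<le> norm v * K"
    using OU_norm[OF t] by (metis mult.commute)
qed

lemma ou_rotate:
  fixes v :: "(real^'d) \<Rightarrow>\<^sub>C (complex^'n)"
  assumes t: "t \<ge> 0"
  shows "ou t v (E h *v x) = (\<integral>z. \<Gamma> t z *v v (E h *v (E t *v x - sqrt t *\<^sub>R z)) \<partial>lborel)"
proof -
  have E: "E t *v (E h *v x) - sqrt t *\<^sub>R (E h *v z) = E h *v (E t *v x - sqrt t *\<^sub>R z)" for z
    using mat_exp_add[of h t S] mat_exp_add[of t h S]
    by (simp add: matrix_vector_mul_assoc matrix_vector_mult_diff_distrib matrix_vector_mult_scaleR add.commute)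
  have "ou t v (E h *v x) = (\<integral>z. \<Gamma> t (E h *v z) *v v (E t *v (E h *v x) - sqrt t *\<^sub>R (E h *v z)) \<partial>lborel)"
    unfolding ou_def by (rule lborel_integral_orthogonal[OF E_orthogonal, symmetric]) (intro \<Gamma>_measurable ou_integrand_measurable)
  moreover have "\<Gamma> t (E h *v z) = \<Gamma> t z" for z
    unfolding \<Gamma>_def by (simp add: gauss_kernel_norm_cong[of "E h *v z" z])
  ultimately show ?thesis by (simp add: E)
qed

lemma OU_semigroup_add:
  fixes v :: "(real^'d) \<Rightarrow>\<^sub>C (complex^'n)"
  assumes t: "t \<ge> 0" and s: "s \<ge> 0"
  shows "OU_semigroup A B S (t + s) v = OU_semigroup A B S t (OU_semigroup A B S s v)"
proof (cases "s = 0")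
  case True
  then show ?thesis by (simp add: OU_semigroup_def)
next
  case False
  with s have s': "s > 0" by simp
  show ?thesis
  proof (rule bcontfun_eqI, simp add: t s, rule coord_eqI)
    fix x k
    define f where "f u = coord (v (E (t + s) *v x - u)) k" for u
    have [measurable]: "f \<in> borel_measurable borel"
      unfolding f_def by measurable
    let ?K = "gauss_kernel (\<alpha> k) :: real^'d \<Rightarrow> complex"
    obtain C where C: "norm (coord u k) \<le> norm u * C" "C \<ge> 0" for u
      using bounded_linear.nonneg_bounded[OF coord_bounded_linear] by blast
    have f: "norm (f u) \<le> norm v * C" for u
      unfolding f_def using C by (meson mult_right_mono norm_bounded order_trans)
    have E: "E s *v (E t *v x - sqrt t *\<^sub>R z) - sqrt s *\<^sub>R w = E (t + s) *v x - (sqrt t *\<^sub>R (E s *v z) + sqrt s *\<^sub>R w)" for z w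
      by (simp add: mat_exp_add matrix_vector_mul_assoc matrix_vector_mult_diff_distrib matrix_vector_mult_scaleR)
    have Ts: "coord (ou s v (E t *v x - sqrt t *\<^sub>R z)) k
      = exp (- (\<beta> k * of_real s)) * (\<integral>w. ?K w * f (sqrt t *\<^sub>R (E s *v z) + sqrt s *\<^sub>R w) \<partial>lborel)" for z
      by (simp add: ou_coord[OF s] E f_def)
    have "coord (ou t (OU_semigroup A B S s v) x) k
      = exp (- (\<beta> k * of_real t)) * (exp (- (\<beta> k * of_real s)) *
          (\<integral>z. ?K (E s *v z) * (\<integral>w. ?K w * f (sqrt t *\<^sub>R (E s *v z) + sqrt s *\<^sub>R w) \<partial>lborel) \<partial>lborel))"
      by (simp add: ou_coord[OF t] s Ts gauss_kernel_norm_cong[of "E s *v _" _] mult.left_commute[of _ "exp (- (\<beta> k * of_real s))"])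
    also have "(\<integral>z. ?K (E s *v z) * (\<integral>w. ?K w * f (sqrt t *\<^sub>R (E s *v z) + sqrt s *\<^sub>R w) \<partial>lborel) \<partial>lborel)
      = (\<integral>z. ?K z * (\<integral>w. ?K w * f (sqrt t *\<^sub>R z + sqrt s *\<^sub>R w) \<partial>lborel) \<partial>lborel)"
      by (rule lborel_integral_orthogonal[OF E_orthogonal]) measurable
    also have "\<dots> = (\<integral>y. ?K y * f (sqrt (t + s) *\<^sub>R y) \<partial>lborel)"
      by (rule gauss_kernel_convolution[OF \<alpha> s' t _ f]) measurable
    also have "exp (- (\<beta> k * of_real t)) * (exp (- (\<beta> k * of_real s)) * \<dots>) = coord (ou (t + s) v x) k"
      using t s by (simp add: ou_coord f_def exp_add[symmetric] distrib_left mult.assoc[symmetric])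
    finally show "coord (ou (t + s) v x) k = coord (ou t (OU_semigroup A B S s v) x) k" by simp
  qed
qed

lemma OU_C_rub:
  fixes v :: "(real^'d) \<Rightarrow>\<^sub>C (complex^'n)"
  assumes t: "t \<ge> 0" and v: "v \<in> C_rub S"
  shows "OU_semigroup A B S t v \<in> C_rub S"
proof -
  define K where "K = Mb * exp (- min_Re_spec B * t)"
  have K: "K \<ge> 0" unfolding K_def Mb_def using cond_number_nonneg[OF Y] by simp
  have small: "\<exists>e'>0. K * e' < e" if "e > 0" for e
    using K that by (intro exI[of _ "e / (K + 1)"]) (auto simp: field_simps)
  show ?thesis
    unfolding C_rub_iff
  proof (intro conjI allI impI)
    show "uniformly_continuous_on UNIV (apply_bcontfun (OU_semigroup A B S t v))"
      unfolding uniformly_continuous_on_def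
    proof (intro allI impI)
      fix e :: real assume "e > 0"
      from small[OF this] obtain e' where e': "e' > 0" "K * e' < e" by blast
      with v obtain d where d: "d > 0" "\<And>x x'. dist x' x < d \<Longrightarrow> dist (v x') (v x) < e'"
        unfolding C_rub_iff uniformly_continuous_on_def by (metis UNIV_I)
      show "\<exists>d>0. \<forall>x\<in>UNIV. \<forall>x'\<in>UNIV. dist x' x < d \<longrightarrow> dist (OU_semigroup A B S t v x') (OU_semigroup A B S t v x) < e"
      proof (intro exI[of _ d] conjI ballI impI d)
        fix x x' :: "real^'d" assume "dist x' x < d"
        then have dE: "norm (E t *v x' - E t *v x) < d"
          by (simp add: dist_norm flip: matrix_vector_mult_diff_distrib)
        have "norm (ou t v x' - ou t v x) \<le> K * e'"
          unfolding K_def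
        proof (rule ou_diff_norm[OF t])
          fix z
          show "norm (v (E t *v x' - sqrt t *\<^sub>R z) - v (E t *v x - sqrt t *\<^sub>R z)) \<le> e'"
            using d(2)[of "E t *v x' - sqrt t *\<^sub>R z" "E t *v x - sqrt t *\<^sub>R z"] dE by (simp add: dist_norm)
        qed
        with e' t show "dist (OU_semigroup A B S t v x') (OU_semigroup A B S t v x) < e" by (simp add: dist_norm)
      qed
    qed
    fix e :: real assume "e > 0"
    from small[OF this] obtain e' where e': "e' > 0" "K * e' < e" by blast
    with v obtain d where d: "d > 0" "\<And>h x. \<bar>h\<bar> < d \<Longrightarrow> norm (v (E (- h) *v x) - v x) \<le> e'"
      unfolding C_rub_iff by meson
    show "\<exists>d>0. \<forall>h x. \<bar>h\<bar> < d \<longrightarrow> norm (OU_semigroup A B S t v (E (- h) *v x) - OU_semigroup A B S t v x) \<le> e"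
    proof (intro exI[of _ d] conjI allI impI d)
      fix h :: real and x :: "real^'d" assume h: "\<bar>h\<bar> < d"
      have m: "(\<lambda>z. v (E (- h) *v (E t *v x - sqrt t *\<^sub>R z))) \<in> borel_measurable borel"
        by (intro bcontfun_measurable borel_measurable_continuous_onI continuous_intros
          linear_continuous_on_compose[OF _ matrix_vector_mul_linear])
      have "ou t v (E (- h) *v x) - ou t v x = (\<integral>z. \<Gamma> t z *v (v (E (- h) *v (E t *v x - sqrt t *\<^sub>R z)) - v (E t *v x - sqrt t *\<^sub>R z)) \<partial>lborel)"
        unfolding ou_rotate[OF t] unfolding ou_def
        by (rule \<Gamma>_integral_diff[OF t m ou_integrand_measurable norm_bounded norm_bounded, symmetric])
      also have "norm \<dots> \<le> K * e'"
        unfolding K_def by (intro \<Gamma>_integral_const(2)[OF t] d(2) h borel_measurable_diff m ou_integrand_measurable)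
      finally show "norm (OU_semigroup A B S t v (E (- h) *v x) - OU_semigroup A B S t v x) \<le> e"
        using e' t by simp
    qed
  qed
qed

lemma ou_minus_norm:
  fixes v :: "(real^'d) \<Rightarrow>\<^sub>C (complex^'n)"
  assumes t: "t \<ge> 0" and \<delta>: "\<delta> > 0" and \<eta>: "\<eta> \<ge> 0"
    and rot: "\<And>x. norm (v (E t *v x) - v x) \<le> \<eta> / 2"
    and uc: "\<And>x y. norm (x - y) < \<delta> \<Longrightarrow> norm (v x - v y) \<le> \<eta> / 2"
  shows "norm (ou t v x - v x) \<le> cond_number Y * exp (- min_Re_spec B * t) *
      (\<eta> * (\<integral>z. \<gamma> z \<partial>lborel) + 2 * norm v / \<delta>\<^sup>2 * t * (\<integral>z. \<gamma> z * (norm z)\<^sup>2 \<partial>lborel))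
    + cond_number Y * (\<Sum>k\<in>UNIV. norm (exp (- (\<beta> k * of_real t)) - 1)) * norm v"
proof -
  let ?\<phi> = "\<lambda>z. v (E t *v x - sqrt t *\<^sub>R z) - v x"
  let ?h = "\<lambda>z :: real^'d. \<eta> + 2 * norm v / \<delta>\<^sup>2 * t * (norm z)\<^sup>2"
  have le: "norm (?\<phi> z) \<le> ?h z" for z
  proof (cases "norm (sqrt t *\<^sub>R z) < \<delta>")
    case True
    then have "norm (v (E t *v x - sqrt t *\<^sub>R z) - v (E t *v x)) \<le> \<eta> / 2" by (intro uc) simp
    then have "norm (?\<phi> z) \<le> \<eta>" using rot[of x] norm_triangle_le_diff[of _ _ "\<eta>"]
      by (smt (verit) field_sum_of_halves norm_diff_triangle_le)
    then show ?thesis using t by (simp add: add_increasing2)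
  next
    case False
    then have "\<delta>\<^sup>2 \<le> (norm (sqrt t *\<^sub>R z))\<^sup>2" using \<delta> by (intro power_mono) auto
    also have "\<dots> = t * (norm z)\<^sup>2" using t by (simp add: power_mult_distrib)
    finally have "2 * norm v * 1 \<le> 2 * norm v * (t * (norm z)\<^sup>2 / \<delta>\<^sup>2)"
      using \<delta> by (intro mult_left_mono) auto
    moreover have "norm (?\<phi> z) \<le> norm v + norm v"
      by (rule order_trans[OF norm_triangle_ineq4 add_mono[OF norm_bounded norm_bounded]])
    ultimately show ?thesis using \<eta> by simp
  qed
  have meas: "?\<phi> \<in> borel_measurable borel" by measurable
  have \<gamma>h: "\<gamma> z * ?h z = \<eta> * \<gamma> z + 2 * norm v / \<delta>\<^sup>2 * t * (\<gamma> z * (norm z)\<^sup>2)" for z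
    by (simp add: algebra_simps)
  have int: "integrable lborel (\<lambda>z. \<gamma> z * ?h z)"
    unfolding \<gamma>h by (intro Bochner_Integration.integrable_add integrable_mult_right \<gamma>_integral)
  have val: "(\<integral>z. \<gamma> z * ?h z \<partial>lborel)
      = \<eta> * (\<integral>z. \<gamma> z \<partial>lborel) + 2 * norm v / \<delta>\<^sup>2 * t * (\<integral>z. \<gamma> z * (norm z)\<^sup>2 \<partial>lborel)"
    unfolding \<gamma>h using \<gamma>_integral
    by (subst Bochner_Integration.integral_add) (auto intro!: integrable_mult_right)
  let ?w = "\<integral>z. \<Gamma> t z *v v x \<partial>lborel"
  have 1: "ou t v x - ?w = (\<integral>z. \<Gamma> t z *v ?\<phi> z \<partial>lborel)"
    unfolding ou_def
    by (rule \<Gamma>_integral_diff[OF t ou_integrand_measurable _ norm_bounded order_refl, symmetric]) simp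
  have 2: "?w - v x = conj_diag Y (\<lambda>k. exp (- (\<beta> k * of_real t)) - 1) *v v x"
  proof (rule coord_eqI)
    fix k
    have "coord ?w k = exp (- (\<beta> k * of_real t)) * coord (v x) k"
      using \<Gamma>_integral_const(3)[OF t, where \<phi> = "\<lambda>_. v x" and c = "norm (v x)" and k = k] gauss_kernel_integral(2)[OF \<alpha>, where 'a = "real^'d"]
      by simp
    then show "coord (?w - v x) k = coord (conj_diag Y (\<lambda>k. exp (- (\<beta> k * of_real t)) - 1) *v v x) k"
      by (simp add: matrix_vector_mult_diff_distrib conj_diag_vector matrix_vector_mul_assoc matrix_inv_both[OF Y] algebra_simps)
  qed
  have "norm (?w - v x) \<le> cond_number Y * (\<Sum>k\<in>UNIV. norm (exp (- (\<beta> k * of_real t)) - 1)) * norm (v x)"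
    unfolding 2 by (intro conj_diag_norm[OF Y] member_le_sum) auto
  also have "\<dots> \<le> cond_number Y * (\<Sum>k\<in>UNIV. norm (exp (- (\<beta> k * of_real t)) - 1)) * norm v"
    by (intro mult_left_mono norm_bounded mult_nonneg_nonneg sum_nonneg cond_number_nonneg[OF Y]) auto
  finally have "norm (?w - v x) \<le> cond_number Y * (\<Sum>k\<in>UNIV. norm (exp (- (\<beta> k * of_real t)) - 1)) * norm v" .
  moreover have "norm (ou t v x - ?w) \<le> cond_number Y * exp (- min_Re_spec B * t) * (\<integral>z. \<gamma> z * ?h z \<partial>lborel)"
    unfolding 1 by (rule \<Gamma>_integral(2)[OF t meas int le])
  ultimately show ?thesis
    unfolding val using norm_triangle_ineq[of "ou t v x - ?w" "?w - v x"] by simp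
qed

lemma OU_continuous_0:
  fixes v :: "(real^'d) \<Rightarrow>\<^sub>C (complex^'n)"
  assumes v: "v \<in> C_rub S"
  shows "((\<lambda>t. OU_semigroup A B S t v) \<longlongrightarrow> v) (at_right 0)"
proof (rule tendstoI)
  fix e :: real assume e: "e > 0"
  let ?I = "\<integral>z. \<gamma> z \<partial>lborel"
  have I: "?I \<ge> 0" by (simp add: \<gamma>_nonneg)
  define \<eta> where "\<eta> = e / (cond_number Y * ?I + 1)"
  have pos: "cond_number Y * ?I + 1 > 0" using I cond_number_nonneg[OF Y] by (simp add: add_nonneg_pos)
  then have \<eta>: "\<eta> > 0" using e by (simp add: \<eta>_def)
  have small: "cond_number Y * ?I * \<eta> < e"
  proof -
    have "cond_number Y * ?I * \<eta> < (cond_number Y * ?I + 1) * \<eta>" using \<eta> by (intro mult_strict_right_mono) auto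
    also have "\<dots> = e" using pos by (simp add: \<eta>_def)
    finally show ?thesis .
  qed
  have \<eta>2: "\<eta> / 2 > 0" using \<eta> by simp
  with v obtain d where d: "d > 0" "\<And>h x. \<bar>h\<bar> < d \<Longrightarrow> norm (v (E (- h) *v x) - v x) \<le> \<eta> / 2"
    unfolding C_rub_iff by meson
  from v \<eta>2 obtain \<delta> where \<delta>: "\<delta> > 0" "\<And>x x'. dist x' x < \<delta> \<Longrightarrow> dist (v x') (v x) < \<eta> / 2"
    unfolding C_rub_iff uniformly_continuous_on_def by (metis UNIV_I)
  let ?f = "\<lambda>t. cond_number Y * exp (- min_Re_spec B * t) *
      (\<eta> * ?I + 2 * norm v / \<delta>\<^sup>2 * t * (\<integral>z. \<gamma> z * (norm z)\<^sup>2 \<partial>lborel))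
    + cond_number Y * (\<Sum>k\<in>UNIV. norm (exp (- (\<beta> k * of_real t)) - 1)) * norm v"
  have "isCont ?f 0" by (intro continuous_intros)
  then have "(?f \<longlongrightarrow> ?f 0) (at_right 0)"
    by (simp only: isCont_def) (rule tendsto_within_subset, auto)
  then have "\<forall>\<^sub>F t in at_right 0. ?f t < e"
    using small by (intro order_tendstoD(2)[of ?f "?f 0"]) (auto simp: mult_ac)
  moreover have "\<forall>\<^sub>F t in at_right 0. 0 < t \<and> t < d"
    using d(1) unfolding eventually_at_right_field by auto
  ultimately show "\<forall>\<^sub>F t in at_right 0. dist (OU_semigroup A B S t v) v < e"
  proof eventually_elim
    case (elim t)
    have "norm (OU_semigroup A B S t v - v) \<le> ?f t"
    proof (rule norm_bound)
      fix x
      have "norm (ou t v x - v x) \<le> ?f t"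
      proof (rule ou_minus_norm)
        show "norm (v (E t *v x) - v x) \<le> \<eta> / 2" for x using d(2)[of "- t" x] elim by simp
        show "norm (v x - v y) \<le> \<eta> / 2" if "norm (x - y) < \<delta>" for x y
          using \<delta>(2)[of x y] that by (simp add: dist_norm)
      qed (use elim \<delta> \<eta> in auto)
      then show "norm ((OU_semigroup A B S t v - v) x) \<le> ?f t" using elim by simp
    qed
    with elim show ?case by (simp add: dist_norm)
  qed
qed

context
  fixes lam :: complex assumes lam: "Re lam + min_Re_spec B > 0"
begin

definition U :: "real \<Rightarrow> ((real^'d) \<Rightarrow>\<^sub>C (complex^'n)) \<Rightarrow> ((real^'d) \<Rightarrow>\<^sub>C (complex^'n))" where
  "U t v = cscale (exp (- lam * of_real t)) (OU_semigroup A B S t v)"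

lemma exp_lam_tendsto:
  "((\<lambda>t. exp (- lam * of_real t)) \<longlongrightarrow> 1) (at_right 0)"
  "((\<lambda>t. (exp (- lam * of_real t) - 1) / of_real t) \<longlongrightarrow> - lam) (at_right 0)"
proof -
  have "isCont (\<lambda>t. exp (- lam * of_real t)) (0 :: real)" by (intro continuous_intros)
  then have "((\<lambda>t. exp (- lam * of_real t)) \<longlongrightarrow> exp (- lam * of_real 0)) (at_right (0 :: real))"
    by (simp only: isCont_def) (rule tendsto_within_subset, auto)
  then show "((\<lambda>t. exp (- lam * of_real t)) \<longlongrightarrow> 1) (at_right 0)" by simp
  have "((\<lambda>z. exp (- lam * z)) has_field_derivative - lam) (at 0)"
    by (auto intro!: derivative_eq_intros)
  then have *: "((\<lambda>h. (exp (- lam * h) - 1) / h) \<longlongrightarrow> - lam) (at 0)"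
    by (simp add: DERIV_def)
  have "filterlim complex_of_real (at 0) (at_right 0)"
    unfolding filterlim_at
    by (auto simp: eventually_at_right_field intro!: exI[of _ 1] tendsto_eq_intros)
  from filterlim_compose[OF * this]
  show "((\<lambda>t. (exp (- lam * of_real t) - 1) / of_real t) \<longlongrightarrow> - lam) (at_right 0)" .
qed

lemmas cscale_tendsto = bounded_bilinear.tendsto[OF bounded_bilinear_cscale]
lemmas cscale_simps =
  bounded_bilinear.add_left[OF bounded_bilinear_cscale] bounded_bilinear.add_right[OF bounded_bilinear_cscale]
  bounded_bilinear.diff_left[OF bounded_bilinear_cscale] bounded_bilinear.diff_right[OF bounded_bilinear_cscale]
  bounded_bilinear.minus_left[OF bounded_bilinear_cscale] bounded_bilinear.minus_right[OF bounded_bilinear_cscale]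
  bounded_bilinear.scaleR_left[OF bounded_bilinear_cscale] bounded_bilinear.scaleR_right[OF bounded_bilinear_cscale]

lemma stable_U: "stable_semigroup (C_rub S) U Mb (Re lam + min_Re_spec B)"
proof (rule stable_semigroup.intro)
  fix t s :: real and v :: "(real^'d) \<Rightarrow>\<^sub>C (complex^'n)"
  show "U 0 v = v" by (simp add: U_def OU_semigroup_def)
  show "bounded_linear (U t)" if "t \<ge> 0"
    unfolding U_def[abs_def]
    by (rule bounded_linear_compose[OF bounded_bilinear.bounded_linear_right[OF bounded_bilinear_cscale] OU_linear[OF that]])
  show "U t v \<in> C_rub S" if "t \<ge> 0" "v \<in> C_rub S"
    unfolding U_def using that by (intro C_rub_cscale OU_C_rub)
  show "U (t + s) v = U t (U s v)" if ts: "t \<ge> 0" "s \<ge> 0"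
  proof -
    have comm: "OU_semigroup A B S t (cscale c w) = cscale c (OU_semigroup A B S t w)" for c w
    proof (rule bcontfun_eqI, simp add: ts, rule coord_eqI)
      fix x k
      have coord_smult: "coord (c *s u) k = c * coord u k" for u
        by (simp add: matrix_vector_mult_def sum_distrib_left mult_ac)
      show "coord (ou t (cscale c w) x) k = coord (c *s ou t w x) k"
        by (simp add: ou_coord[OF ts(1)] coord_smult mult.left_commute[of _ c])
    qed
    show ?thesis
      by (simp only: U_def OU_semigroup_add[OF ts] comm cscale_cscale exp_add[symmetric]) (simp add: algebra_simps)
  qed
  show "norm (U t v) \<le> Mb * exp (- (Re lam + min_Re_spec B) * t) * norm v" if t: "t \<ge> 0"
  proof -
    have "norm (U t v) \<le> norm (exp (- lam * of_real t)) * (Mb * exp (- min_Re_spec B * t) * norm v)"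
      unfolding U_def by (intro order_trans[OF norm_cscale_le] mult_left_mono OU_norm t) auto
    also have "norm (exp (- lam * of_real t)) = exp (- Re lam * t)" by simp
    also have "exp (- Re lam * t) * (Mb * exp (- min_Re_spec B * t) * norm v)
      = Mb * (exp (- Re lam * t) * exp (- min_Re_spec B * t)) * norm v" by simp
    also have "exp (- Re lam * t) * exp (- min_Re_spec B * t) = exp (- (Re lam + min_Re_spec B) * t)"
      by (simp add: exp_add[symmetric] algebra_simps)
    finally show ?thesis .
  qed
  show "((\<lambda>t. U t v) \<longlongrightarrow> v) (at_right 0)" if "v \<in> C_rub S"
    unfolding U_def using cscale_tendsto[OF exp_lam_tendsto(1) OU_continuous_0[OF that]] by simp
qed (use lam C_rub_subspace C_rub_closed in auto)

lemma U_generator_iff: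
  "((\<lambda>t. (OU_semigroup A B S t v - v) /\<^sub>R t) \<longlongrightarrow> w) (at_right 0)
    \<longleftrightarrow> ((\<lambda>t. (U t v - v) /\<^sub>R t) \<longlongrightarrow> w - cscale lam v) (at_right 0)" (is "?L \<longleftrightarrow> ?R")
proof -
  let ?e = "\<lambda>t. exp (- lam * of_real t)" and ?T = "\<lambda>t. OU_semigroup A B S t v"
  have eq: "(U t v - v) /\<^sub>R t = cscale (?e t) ((?T t - v) /\<^sub>R t) + cscale ((?e t - 1) / of_real t) v" for t
  proof -
    have quot: "(?e t - 1) / of_real t = (?e t - 1) /\<^sub>R t" by (simp add: scaleR_conv_of_real field_simps)
    show ?thesis by (simp only: U_def quot cscale_simps cscale_one) (simp add: algebra_simps)
  qed
  have eq': "(?T t - v) /\<^sub>R t = cscale (exp (lam * of_real t)) ((U t v - v) /\<^sub>R t - cscale ((?e t - 1) / of_real t) v)" for t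
    unfolding eq by (simp add: exp_add[symmetric])
  have lim2: "((\<lambda>t. cscale ((?e t - 1) / of_real t) v) \<longlongrightarrow> cscale (- lam) v) (at_right 0)"
    by (intro cscale_tendsto exp_lam_tendsto tendsto_const)
  show ?thesis
  proof
    assume ?L
    from tendsto_add[OF cscale_tendsto[OF exp_lam_tendsto(1) this] lim2] show ?R
      unfolding eq by (simp add: cscale_simps)
  next
    assume R: ?R
    have "((\<lambda>t. inverse (?e t)) \<longlongrightarrow> inverse 1) (at_right 0)"
      by (intro tendsto_inverse exp_lam_tendsto) simp
    then have "((\<lambda>t. exp (lam * of_real t)) \<longlongrightarrow> 1) (at_right 0)"
      by (simp add: exp_minus)
    from cscale_tendsto[OF this tendsto_diff[OF R lim2]] show ?L
      unfolding eq' by (simp add: cscale_simps)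
  qed
qed

lemma resolvent:
  fixes g :: "(real^'d) \<Rightarrow>\<^sub>C (complex^'n)"
  assumes g: "g \<in> C_rub S"
  shows "\<exists>v\<in>D_b A B S.
      cscale lam v - A_b A B S v = g \<and>
      (\<forall>w\<in>D_b A B S. cscale lam w - A_b A B S w = g \<longrightarrow> w = v) \<and>
      v = inv_into (D_b A B S) (\<lambda>w. cscale lam w - A_b A B S w) g \<and>
      ((\<lambda>t. cscale (exp (- lam * of_real t)) (OU_semigroup A B S t g)) has_integral v) {0..} \<and>
      (\<forall>x. ((\<lambda>t. exp (- lam * of_real t) *s
               (\<integral>\<xi>. heat_kernel A B S x \<xi> t *v g \<xi> \<partial>lborel)) has_integral v x) {0<..}) \<and>
      norm v \<le> Mb / (Re lam + min_Re_spec B) * norm g"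
proof -
  interpret stable_semigroup "C_rub S" U Mb "Re lam + min_Re_spec B" by (rule stable_U)
  let ?v = "R g"
  have vX: "?v \<in> C_rub S" by (rule R_in[OF g])
  have gen: "((\<lambda>t. (OU_semigroup A B S t ?v - ?v) /\<^sub>R t) \<longlongrightarrow> cscale lam ?v - g) (at_right 0)"
    using R_generator[OF g] unfolding U_generator_iff by simp
  have wX: "cscale lam ?v - g \<in> C_rub S"
    by (intro subspace_diff[OF C_rub_subspace] C_rub_cscale vX g)
  have vD: "?v \<in> D_b A B S" using vX wX gen by (auto simp: D_b_def generator_dom_def)
  have "A_b A B S ?v = cscale lam ?v - g"
    unfolding A_b_def generator_def by (rule tendsto_Lim[OF _ gen]) simp
  then have sol: "cscale lam ?v - A_b A B S ?v = g" by simp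
  have uniq: "w = ?v" if w: "w \<in> D_b A B S" "cscale lam w - A_b A B S w = g" for w
  proof -
    from w(1) obtain y where y: "w \<in> C_rub S" "y \<in> C_rub S"
        "((\<lambda>t. (OU_semigroup A B S t w - w) /\<^sub>R t) \<longlongrightarrow> y) (at_right 0)"
      by (auto simp: D_b_def generator_dom_def)
    have "A_b A B S w = y"
      unfolding A_b_def generator_def by (rule tendsto_Lim[OF _ y(3)]) simp
    with w(2) have "y - cscale lam w = - g" by (simp add: algebra_simps)
    with y(3) have "((\<lambda>t. (U t w - w) /\<^sub>R t) \<longlongrightarrow> - g) (at_right 0)"
      unfolding U_generator_iff by simp
    from generator_R[OF y(1) _ this] subspace_neg[OF C_rub_subspace g] show "w = ?v" by simp
  qed
  let ?F = "\<lambda>w. cscale lam w - A_b A B S w"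
  let ?i = "inv_into (D_b A B S) ?F g"
  have "g \<in> ?F ` D_b A B S" using vD sol by force
  then have "?i \<in> D_b A B S" "?F ?i = g" by (auto intro: inv_into_into f_inv_into_f)
  then have inv: "?v = ?i" by (rule uniq[symmetric])
  have int: "((\<lambda>t. U t g) has_integral ?v) {0..}" by (rule has_integral_R[OF g])
  have pw: "((\<lambda>t. exp (- lam * of_real t) *s
      (\<integral>\<xi>. heat_kernel A B S x \<xi> t *v g \<xi> \<partial>lborel)) has_integral ?v x) {0<..}" for x
  proof -
    have "bounded_linear (\<lambda>v :: (real^'d) \<Rightarrow>\<^sub>C (complex^'n). v x)"
      by (rule bounded_linear_intro[where K = 1]) (simp_all add: norm_bounded)
    from has_integral_linear[OF int this]
    have "((\<lambda>t. U t g x) has_integral ?v x) {0..}" by (simp add: o_def)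
    moreover have "negligible {t \<in> {0..} - {0<..}. U t g x \<noteq> 0}"
      by (rule negligible_subset[of "{0::real}"]) auto
    moreover have "negligible {t \<in> {0<..} - {0..}. U t g x \<noteq> 0}"
      by (rule negligible_subset[of "{0::real}"]) auto
    ultimately have "((\<lambda>t. U t g x) has_integral ?v x) {0<..}"
      using has_integral_spike_set_eq[of "{0..}" "{0<..}" "\<lambda>t. U t g x"] by blast
    then show ?thesis
      by (rule has_integral_eq[rotated]) (simp add: U_def ou_heat_kernel)
  qed
  show ?thesis
  proof (rule bexI[OF _ vD], intro conjI ballI impI allI)
    show "((\<lambda>t. cscale (exp (- lam * of_real t)) (OU_semigroup A B S t g)) has_integral ?v) {0..}"
      using int by (simp only: U_def)
  qed (use sol uniq pw norm_R[OF g] in simp_all, rule inv)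
qed

end

end

theorem corollary6p5:
  fixes A B Y :: "complex^'n^'n" and S :: "real^'d^'d"
    and lam :: complex and \<omega>b Mb :: real
    and g :: "(real^'d) \<Rightarrow>\<^sub>C (complex^'n)"
  assumes "CARD('d) \<ge> 2"
    and "diagonalizes Y A" and "diagonalizes Y B"
    and "\<forall>\<mu>\<in>spectrum A. Re \<mu> > 0"
    and "transpose S = - S"
    and "\<omega>b = - min_Re_spec B"
    and "Mb = cond_number Y * a_one A powr (real CARD('d) / 2)"
    and "Re lam > \<omega>b"
    and "g \<in> C_rub S"
  shows "\<exists>v\<in>D_b A B S.
      cscale lam v - A_b A B S v = g \<and>
      (\<forall>w\<in>D_b A B S. cscale lam w - A_b A B S w = g \<longrightarrow> w = v) \<and>
      v = inv_into (D_b A B S) (\<lambda>w. cscale lam w - A_b A B S w) g \<and>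
      ((\<lambda>t. cscale (exp (- lam * of_real t)) (OU_semigroup A B S t g)) has_integral v) {0..} \<and>
      (\<forall>x. ((\<lambda>t. exp (- lam * of_real t) *s
               (\<integral>\<xi>. heat_kernel A B S x \<xi> t *v g \<xi> \<partial>lborel)) has_integral v x) {0<..}) \<and>
      norm v \<le> Mb / (Re lam - \<omega>b) * norm g"
proof -
  obtain \<alpha> where Y: "invertible Y" and A: "A = conj_diag Y \<alpha>"
    using diagonalizes_conj_diag[OF assms(2)] .
  obtain \<beta> where B: "B = conj_diag Y \<beta>"
    using diagonalizes_conj_diag[OF assms(3)] .
  interpret ou_kernel Y \<alpha> \<beta> S
    using Y assms(4,5) by unfold_locales (auto simp: A conj_diag_spectrum[OF Y])
  have "Re lam + min_Re_spec B > 0" using assms(6,8) by simp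
  from resolvent[OF this[unfolded B] assms(9)] show ?thesis
    unfolding A[symmetric] B[symmetric] Mb_def assms(6,7) by simp
qed

end
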